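(* Let $M$ be an invariant submanifold of a generalized Sasakian-space-form $\overline{M}^{2n+1}(f_1,f_2,f_3)$ with $f_1\neq f_3$ at every point. Then $M$ is totally geodesic if and only if $M$ is semiparallel.
   Context: An almost contact metric manifold $(\overline M,\phi,\xi,\eta,g)$ is a Riemannian manifold $(\overline M,g)$ with a $(1,1)$-tensor field $\phi$, a vector field $\xi$ and a $1$-form $\eta$ such that $\phi^2X=-X+\eta(X)\xi$, $\phi\xi=0$, $\eta(\xi)=1$, $g(X,\xi)=\eta(X)$, $\eta(\phi X)=0$, $g(\phi X,\phi Y)=g(X,Y)-\eta(X)\eta(Y)$. Curvature convention: $R(X,Y)=[\nabla_X,\nabla_Y]-\nabla_{[X,Y]}$. A generalized Sasakian-space-form $\overline M^{2n+1}(f_1,f_2,f_3)$ is an almost contact metric manifold of dimension $2n+1$, $n>1$, with smooth functions $f_1,f_2,f_3$ on $\overline M$ such that the curvature tensor $\overline R$ of its Levi-Civita connection $\overline\nabla$ satisfies $\overline R(X,Y)Z=f_1\{g(Y,Z)X-g(X,Z)Y\}+f_2\{g(X,\phi Z)\phi Y-g(Y,\phi Z)\phi X+2g(X,\phi Y)\phi Z\}+f_3\{\eta(X)\eta(Z)Y-\eta(Y)\eta(Z)X+g(X,Z)\eta(Y)\xi-g(Y,Z)\eta(X)\xi\}.$ Throughout, the following structure equations also hold on $\overline M$: $(\overline\nabla_X\phi)(Y)=(f_1-f_3)[g(X,Y)\xi-\eta(Y)X]$ and $\overline\nabla_X\xi=-(f_1-f_3)\phi X$. A submanifold $M$ of $\overline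 M$ is invariant if $\xi$ is tangent to $M$ and $\phi(TM)\subset TM$ at every point of $M$. $M$ carries the induced metric and Levi-Civita connection $\nabla$ with curvature tensor $R$, the normal connection $\nabla^\perp$ with curvature $R^\perp(X,Y)=[\nabla^\perp_X,\nabla^\perp_Y]-\nabla^\perp_{[X,Y]}$, and the second fundamental form $h$, with $\overline\nabla_XY=\nabla_XY+h(X,Y)$. $M$ is totally geodesic if $h=0$. $M$ is semiparallel if, for all $X,Y,Z,U$ tangent to $M$, $(\overline R(X,Y)\cdot h)(Z,U):=R^\perp(X,Y)h(Z,U)-h(R(X,Y)Z,U)-h(Z,R(X,Y)U)=0$. *)

theory Defs
  imports "HOL-Analysis.Analysis"
begin

section \<open>Smooth manifolds\<close>

primrec Ck_on :: "nat \<Rightarrow> 'e::euclidean_space set \<Rightarrow> ('e \<Rightarrow> 'w::real_normed_vector) \<Rightarrow> bool" where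
  "Ck_on 0 S F \<longleftrightarrow> continuous_on S F"
| "Ck_on (Suc k) S F \<longleftrightarrow> (\<forall>x\<in>S. F differentiable (at x)) \<and>
     (\<forall>v. Ck_on k S (\<lambda>x. frechet_derivative F (at x) v))"

text \<open>Only used for open \<open>S\<close>.\<close>
definition smooth_on :: "'e::euclidean_space set \<Rightarrow> ('e \<Rightarrow> 'w::real_normed_vector) \<Rightarrow> bool" where
  "smooth_on S F \<longleftrightarrow> (\<forall>k. Ck_on k S F)"

text \<open>A chart is a domain together with a coordinate map, which is only meaningful on the domain.\<close>
type_synonym ('a, 'e) chart = "'a set \<times> ('a \<Rightarrow> 'e)"

abbreviation chart_dom :: "('a, 'e) chart \<Rightarrow> 'a set" where
  "chart_dom \<equiv> fst"

abbreviation coord :: "('a, 'e) chart \<Rightarrow> 'a \<Rightarrow> 'e" where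
  "coord \<equiv> snd"

definition chart_inv :: "('a, 'e) chart \<Rightarrow> 'e \<Rightarrow> 'a" where
  "chart_inv c = inv_into (chart_dom c) (coord c)"

definition smooth_manifold :: "'a topology \<Rightarrow> ('a, 'e::euclidean_space) chart set \<Rightarrow> bool" where
  "smooth_manifold T A \<longleftrightarrow>
     Hausdorff_space T \<and> second_countable T \<and>
     (\<Union>c\<in>A. chart_dom c) = topspace T \<and>
     (\<forall>c\<in>A. openin T (chart_dom c) \<and> open (coord c ` chart_dom c) \<and>
        homeomorphic_map (subtopology T (chart_dom c)) (top_of_set (coord c ` chart_dom c)) (coord c)) \<and>
     (\<forall>c\<in>A. \<forall>d\<in>A. smooth_on (coord c ` (chart_dom c \<inter> chart_dom d)) (coord d \<circ> chart_inv c))"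

definition smooth_fun ::
    "('a, 'e::euclidean_space) chart set \<Rightarrow> 'a set \<Rightarrow> ('a \<Rightarrow> 'w::real_normed_vector) \<Rightarrow> bool" where
  "smooth_fun A U F \<longleftrightarrow> (\<forall>c\<in>A. smooth_on (coord c ` (U \<inter> chart_dom c)) (F \<circ> chart_inv c))"

text \<open>Differential at \<open>p\<close> of \<open>F\<close>, read in the chart \<open>c\<close>. For \<open>F = coord d\<close> this is the Jacobian of
  the change of coordinates from \<open>c\<close> to \<open>d\<close>.\<close>
definition chart_deriv ::
    "('a, 'e::euclidean_space) chart \<Rightarrow> ('a \<Rightarrow> 'w::real_normed_vector) \<Rightarrow> 'a \<Rightarrow> 'e \<Rightarrow> 'w" where
  "chart_deriv c F p = frechet_derivative (F \<circ> chart_inv c) (at (coord c p))"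


section \<open>Vector fields and tensor fields\<close>

text \<open>A tangent vector at \<open>p\<close> is given by its components in all charts around \<open>p\<close>, subject to the
  transformation law; accordingly \<open>X c p\<close> is the vector of components in the chart \<open>c\<close> of the
  value of the vector field \<open>X\<close> at \<open>p\<close>. Tensor fields are treated in the same way. Values at
  points outside \<open>U\<close> or \<open>chart_dom c\<close> are irrelevant.\<close>

type_synonym ('a, 'e) field = "('a, 'e) chart \<Rightarrow> 'a \<Rightarrow> 'e"

definition smooth_vector_field ::
    "'a topology \<Rightarrow> ('a, 'e::euclidean_space) chart set \<Rightarrow> 'a set \<Rightarrow> ('a, 'e) field \<Rightarrow> bool" where
  "smooth_vector_field T A U X \<longleftrightarrow>
     openin T U \<and>
     (\<forall>c\<in>A. smooth_fun A (U \<inter> chart_dom c) (X c)) \<and>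
     (\<forall>c\<in>A. \<forall>d\<in>A. \<forall>p \<in> U \<inter> chart_dom c \<inter> chart_dom d.
        X d p = chart_deriv c (coord d) p (X c p))"

definition smooth_one_form ::
    "('a, 'e::euclidean_space) chart set \<Rightarrow> (('a, 'e) chart \<Rightarrow> 'a \<Rightarrow> 'e \<Rightarrow> real) \<Rightarrow> bool" where
  "smooth_one_form A \<eta> \<longleftrightarrow>
     (\<forall>c\<in>A. (\<forall>p\<in>chart_dom c. linear (\<eta> c p)) \<and>
        (\<forall>x. smooth_fun A (chart_dom c) (\<lambda>p. \<eta> c p x))) \<and>
     (\<forall>c\<in>A. \<forall>d\<in>A. \<forall>p \<in> chart_dom c \<inter> chart_dom d. \<forall>x.
        \<eta> d p (chart_deriv c (coord d) p x) = \<eta> c p x)"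

definition smooth_endo_field ::
    "('a, 'e::euclidean_space) chart set \<Rightarrow> (('a, 'e) chart \<Rightarrow> 'a \<Rightarrow> 'e \<Rightarrow> 'e) \<Rightarrow> bool" where
  "smooth_endo_field A \<phi> \<longleftrightarrow>
     (\<forall>c\<in>A. (\<forall>p\<in>chart_dom c. linear (\<phi> c p)) \<and>
        (\<forall>x. smooth_fun A (chart_dom c) (\<lambda>p. \<phi> c p x))) \<and>
     (\<forall>c\<in>A. \<forall>d\<in>A. \<forall>p \<in> chart_dom c \<inter> chart_dom d. \<forall>x.
        \<phi> d p (chart_deriv c (coord d) p x) = chart_deriv c (coord d) p (\<phi> c p x))"

definition riemannian_metric ::
    "('a, 'e::euclidean_space) chart set \<Rightarrow> (('a, 'e) chart \<Rightarrow> 'a \<Rightarrow> 'e \<Rightarrow> 'e \<Rightarrow> real) \<Rightarrow> bool" where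
  "riemannian_metric A g \<longleftrightarrow>
     (\<forall>c\<in>A. \<forall>p\<in>chart_dom c.
        bilinear (g c p) \<and> (\<forall>x y. g c p x y = g c p y x) \<and> (\<forall>x. x \<noteq> 0 \<longrightarrow> g c p x x > 0)) \<and>
     (\<forall>c\<in>A. \<forall>x y. smooth_fun A (chart_dom c) (\<lambda>p. g c p x y)) \<and>
     (\<forall>c\<in>A. \<forall>d\<in>A. \<forall>p \<in> chart_dom c \<inter> chart_dom d. \<forall>x y.
        g d p (chart_deriv c (coord d) p x) (chart_deriv c (coord d) p y) = g c p x y)"

definition chart_at :: "('a, 'e) chart set \<Rightarrow> 'a \<Rightarrow> ('a, 'e) chart" where
  "chart_at A p = (SOME c. c \<in> A \<and> p \<in> chart_dom c)"

text \<open>The derivative \<open>X(F)\<close> at \<open>p\<close>. By the chain rule and the transformation law of \<open>X\<close> it does not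
  depend on the chart used, so an arbitrary one is chosen.\<close>
definition dir_deriv ::
    "('a, 'e::euclidean_space) chart set \<Rightarrow> ('a, 'e) field \<Rightarrow> ('a \<Rightarrow> 'w::real_normed_vector) \<Rightarrow> 'a \<Rightarrow> 'w" where
  "dir_deriv A X F p = chart_deriv (chart_at A p) F p (X (chart_at A p) p)"

text \<open>\<open>[X,Y]\<^sup>k = X(Y\<^sup>k) - Y(X\<^sup>k)\<close>\<close>
definition lie_bracket ::
    "('a, 'e::euclidean_space) chart set \<Rightarrow> ('a, 'e) field \<Rightarrow> ('a, 'e) field \<Rightarrow> ('a, 'e) field" where
  "lie_bracket A X Y = (\<lambda>c p. dir_deriv A X (Y c) p - dir_deriv A Y (X c) p)"


section \<open>Connections\<close>

text \<open>A connection is represented by its Christoffel symbols \<open>\<Gamma> c p x y\<close> in every chart: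
  \<open>(\<nabla>\<^sub>X Y)\<^sup>k = X(Y\<^sup>k) + \<Gamma>\<^sup>k(X,Y)\<close>.\<close>

type_synonym ('a, 'e) christoffel = "('a, 'e) chart \<Rightarrow> 'a \<Rightarrow> 'e \<Rightarrow> 'e \<Rightarrow> 'e"

definition nabla ::
    "('a, 'e::euclidean_space) chart set \<Rightarrow> ('a, 'e) christoffel \<Rightarrow>
     ('a, 'e) field \<Rightarrow> ('a, 'e) field \<Rightarrow> ('a, 'e) field" where
  "nabla A \<Gamma> X Y = (\<lambda>c p. dir_deriv A X (Y c) p + \<Gamma> c p (X c p) (Y c p))"

text \<open>The last clause encodes the transformation law of the Christoffel symbols: the local
  expressions of \<open>\<nabla>\<^sub>X Y\<close> fit together to a vector field.\<close>
definition affine_connection ::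
    "'a topology \<Rightarrow> ('a, 'e::euclidean_space) chart set \<Rightarrow> ('a, 'e) christoffel \<Rightarrow> bool" where
  "affine_connection T A \<Gamma> \<longleftrightarrow>
     (\<forall>c\<in>A. (\<forall>p\<in>chart_dom c. bilinear (\<Gamma> c p)) \<and>
        (\<forall>x y. smooth_fun A (chart_dom c) (\<lambda>p. \<Gamma> c p x y))) \<and>
     (\<forall>U X Y. smooth_vector_field T A U X \<and> smooth_vector_field T A U Y \<longrightarrow>
        smooth_vector_field T A U (nabla A \<Gamma> X Y))"

definition levi_civita ::
    "'a topology \<Rightarrow> ('a, 'e::euclidean_space) chart set \<Rightarrow>
     (('a, 'e) chart \<Rightarrow> 'a \<Rightarrow> 'e \<Rightarrow> 'e \<Rightarrow> real) \<Rightarrow> ('a, 'e) christoffel \<Rightarrow> bool" where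
  "levi_civita T A g \<Gamma> \<longleftrightarrow>
     affine_connection T A \<Gamma> \<and>
     (\<forall>U X Y. smooth_vector_field T A U X \<and> smooth_vector_field T A U Y \<longrightarrow>
        (\<forall>c\<in>A. \<forall>p \<in> U \<inter> chart_dom c.
           nabla A \<Gamma> X Y c p - nabla A \<Gamma> Y X c p = lie_bracket A X Y c p)) \<and>
     (\<forall>U X Y Z. smooth_vector_field T A U X \<and> smooth_vector_field T A U Y \<and>
          smooth_vector_field T A U Z \<longrightarrow>
        (\<forall>c\<in>A. \<forall>p \<in> U \<inter> chart_dom c.
           dir_deriv A X (\<lambda>p. g c p (Y c p) (Z c p)) p =
             g c p (nabla A \<Gamma> X Y c p) (Z c p) + g c p (Y c p) (nabla A \<Gamma> X Z c p)))"

definition curvature ::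
    "('a, 'e::euclidean_space) chart set \<Rightarrow> ('a, 'e) christoffel \<Rightarrow>
     ('a, 'e) field \<Rightarrow> ('a, 'e) field \<Rightarrow> ('a, 'e) field \<Rightarrow> ('a, 'e) field" where
  "curvature A \<Gamma> X Y Z = (\<lambda>c p.
     nabla A \<Gamma> X (nabla A \<Gamma> Y Z) c p - nabla A \<Gamma> Y (nabla A \<Gamma> X Z) c p
       - nabla A \<Gamma> (lie_bracket A X Y) Z c p)"


section \<open>Generalized Sasakian-space-forms\<close>

definition almost_contact_metric_manifold ::
    "'a topology \<Rightarrow> ('a, 'e::euclidean_space) chart set \<Rightarrow>
     (('a, 'e) chart \<Rightarrow> 'a \<Rightarrow> 'e \<Rightarrow> 'e) \<Rightarrow> ('a, 'e) field \<Rightarrow> (('a, 'e) chart \<Rightarrow> 'a \<Rightarrow> 'e \<Rightarrow> real) \<Rightarrow>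
     (('a, 'e) chart \<Rightarrow> 'a \<Rightarrow> 'e \<Rightarrow> 'e \<Rightarrow> real) \<Rightarrow> bool" where
  "almost_contact_metric_manifold T A \<phi> \<xi> \<eta> g \<longleftrightarrow>
     smooth_manifold T A \<and> smooth_endo_field A \<phi> \<and>
     smooth_vector_field T A (topspace T) \<xi> \<and> smooth_one_form A \<eta> \<and> riemannian_metric A g \<and>
     (\<forall>c\<in>A. \<forall>p\<in>chart_dom c.
        (\<forall>x. \<phi> c p (\<phi> c p x) = - x + \<eta> c p x *\<^sub>R \<xi> c p) \<and>
        \<phi> c p (\<xi> c p) = 0 \<and>
        \<eta> c p (\<xi> c p) = 1 \<and>
        (\<forall>x. g c p x (\<xi> c p) = \<eta> c p x) \<and>
        (\<forall>x. \<eta> c p (\<phi> c p x) = 0) \<and>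
        (\<forall>x y. g c p (\<phi> c p x) (\<phi> c p y) = g c p x y - \<eta> c p x * \<eta> c p y))"

text \<open>\<open>\<Gamma>\<close> is the Levi-Civita connection of \<open>g\<close>. The last two clauses are the structure equations for
  \<open>(\<nabla>\<^sub>X \<phi>)(Y) = \<nabla>\<^sub>X (\<phi> Y) - \<phi> (\<nabla>\<^sub>X Y)\<close> and \<open>\<nabla>\<^sub>X \<xi>\<close>.\<close>
definition gen_sasakian_space_form ::
    "nat \<Rightarrow> 'a topology \<Rightarrow> ('a, 'e::euclidean_space) chart set \<Rightarrow>
     (('a, 'e) chart \<Rightarrow> 'a \<Rightarrow> 'e \<Rightarrow> 'e) \<Rightarrow> ('a, 'e) field \<Rightarrow> (('a, 'e) chart \<Rightarrow> 'a \<Rightarrow> 'e \<Rightarrow> real) \<Rightarrow>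
     (('a, 'e) chart \<Rightarrow> 'a \<Rightarrow> 'e \<Rightarrow> 'e \<Rightarrow> real) \<Rightarrow> ('a, 'e) christoffel \<Rightarrow>
     ('a \<Rightarrow> real) \<Rightarrow> ('a \<Rightarrow> real) \<Rightarrow> ('a \<Rightarrow> real) \<Rightarrow> bool" where
  "gen_sasakian_space_form n T A \<phi> \<xi> \<eta> g \<Gamma> f1 f2 f3 \<longleftrightarrow>
     n > 1 \<and> DIM('e) = 2 * n + 1 \<and>
     almost_contact_metric_manifold T A \<phi> \<xi> \<eta> g \<and> levi_civita T A g \<Gamma> \<and>
     smooth_fun A (topspace T) f1 \<and> smooth_fun A (topspace T) f2 \<and> smooth_fun A (topspace T) f3 \<and>
     (\<forall>U X Y Z. smooth_vector_field T A U X \<and> smooth_vector_field T A U Y \<and>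
          smooth_vector_field T A U Z \<longrightarrow>
        (\<forall>c\<in>A. \<forall>p \<in> U \<inter> chart_dom c.
           let x = X c p; y = Y c p; z = Z c p;
               G = g c p; P = \<phi> c p; E = \<eta> c p; v = \<xi> c p
           in curvature A \<Gamma> X Y Z c p =
                f1 p *\<^sub>R (G y z *\<^sub>R x - G x z *\<^sub>R y)
              + f2 p *\<^sub>R (G x (P z) *\<^sub>R P y - G y (P z) *\<^sub>R P x + (2 * G x (P y)) *\<^sub>R P z)
              + f3 p *\<^sub>R ((E x * E z) *\<^sub>R y - (E y * E z) *\<^sub>R x
                         + (G x z * E y) *\<^sub>R v - (G y z * E x) *\<^sub>R v))) \<and>
     (\<forall>U X Y. smooth_vector_field T A U X \<and> smooth_vector_field T A U Y \<longrightarrow>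
        (\<forall>c\<in>A. \<forall>p \<in> U \<inter> chart_dom c.
           nabla A \<Gamma> X (\<lambda>c p. \<phi> c p (Y c p)) c p - \<phi> c p (nabla A \<Gamma> X Y c p) =
             (f1 p - f3 p) *\<^sub>R (g c p (X c p) (Y c p) *\<^sub>R \<xi> c p - \<eta> c p (Y c p) *\<^sub>R X c p))) \<and>
     (\<forall>U X. smooth_vector_field T A U X \<longrightarrow>
        (\<forall>c\<in>A. \<forall>p \<in> U \<inter> chart_dom c.
           nabla A \<Gamma> X \<xi> c p = - ((f1 p - f3 p) *\<^sub>R \<phi> c p (X c p))))"


section \<open>Submanifolds\<close>

text \<open>A submanifold of \<open>(T, A)\<close> is a manifold \<open>(S, B)\<close> with an immersion \<open>\<iota>\<close>; embedded submanifolds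
  are the case where \<open>S\<close> is a subspace of \<open>T\<close> and \<open>\<iota>\<close> the inclusion.\<close>
definition immersion ::
    "'b topology \<Rightarrow> ('b, 'f::euclidean_space) chart set \<Rightarrow>
     'a topology \<Rightarrow> ('a, 'e::euclidean_space) chart set \<Rightarrow> ('b \<Rightarrow> 'a) \<Rightarrow> bool" where
  "immersion S B T A \<iota> \<longleftrightarrow>
     smooth_manifold S B \<and> smooth_manifold T A \<and> continuous_map S T \<iota> \<and>
     (\<forall>a\<in>A. smooth_fun B {q \<in> topspace S. \<iota> q \<in> chart_dom a} (coord a \<circ> \<iota>)) \<and>
     (\<forall>a\<in>A. \<forall>b\<in>B. \<forall>q\<in>chart_dom b. \<iota> q \<in> chart_dom a \<longrightarrow> inj (chart_deriv b (coord a \<circ> \<iota>) q))"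

text \<open>A vector field along \<open>\<iota>\<close> is given by components \<open>W a q\<close> of \<open>W(q) \<in> T\<^bsub>\<iota>(q)\<^esub>\<close> in the charts \<open>a\<close> of
  the ambient manifold around \<open>\<iota> q\<close>.\<close>
type_synonym ('b, 'a, 'e) field_along = "('a, 'e) chart \<Rightarrow> 'b \<Rightarrow> 'e"

text \<open>\<open>d\<iota>(X)\<close>, with components \<open>X(x\<^sup>k \<circ> \<iota>)\<close>.\<close>
definition push ::
    "('b, 'f::euclidean_space) chart set \<Rightarrow> ('b \<Rightarrow> 'a) \<Rightarrow> ('b, 'f) field \<Rightarrow>
     ('b, 'a, 'e::euclidean_space) field_along" where
  "push B \<iota> X = (\<lambda>a q. dir_deriv B X (coord a \<circ> \<iota>) q)"

text \<open>The tangent space of the submanifold at \<open>q\<close>, as a subspace of the ambient tangent space at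
  \<open>\<iota> q\<close>, in the components of the chart \<open>a\<close>.\<close>
definition tangent_space ::
    "('b, 'f::euclidean_space) chart set \<Rightarrow> ('b \<Rightarrow> 'a) \<Rightarrow> ('a, 'e::euclidean_space) chart \<Rightarrow> 'b \<Rightarrow> 'e set" where
  "tangent_space B \<iota> a q =
     {chart_deriv b (coord a \<circ> \<iota>) q v | b v. b \<in> B \<and> q \<in> chart_dom b}"

definition normal_part ::
    "('b, 'f::euclidean_space) chart set \<Rightarrow> ('b \<Rightarrow> 'a) \<Rightarrow>
     (('a, 'e::euclidean_space) chart \<Rightarrow> 'a \<Rightarrow> 'e \<Rightarrow> 'e \<Rightarrow> real) \<Rightarrow> ('a, 'e) chart \<Rightarrow> 'b \<Rightarrow> 'e \<Rightarrow> 'e" where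
  "normal_part B \<iota> g a q w =
     (THE \<nu>. w - \<nu> \<in> tangent_space B \<iota> a q \<and> (\<forall>t\<in>tangent_space B \<iota> a q. g a (\<iota> q) \<nu> t = 0))"

definition induced_metric ::
    "('b, 'f::euclidean_space) chart set \<Rightarrow> ('a, 'e::euclidean_space) chart set \<Rightarrow> ('b \<Rightarrow> 'a) \<Rightarrow>
     (('a, 'e) chart \<Rightarrow> 'a \<Rightarrow> 'e \<Rightarrow> 'e \<Rightarrow> real) \<Rightarrow> (('b, 'f) chart \<Rightarrow> 'b \<Rightarrow> 'f \<Rightarrow> 'f \<Rightarrow> real) \<Rightarrow> bool" where
  "induced_metric B A \<iota> g gM \<longleftrightarrow>
     (\<forall>b\<in>B. \<forall>a\<in>A. \<forall>q\<in>chart_dom b. \<iota> q \<in> chart_dom a \<longrightarrow>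
        (\<forall>x y. gM b q x y =
           g a (\<iota> q) (chart_deriv b (coord a \<circ> \<iota>) q x) (chart_deriv b (coord a \<circ> \<iota>) q y)))"

text \<open>Ambient covariant derivative of a vector field \<open>W\<close> along \<open>\<iota>\<close> in a direction \<open>X\<close> tangent to the
  submanifold (the pullback connection).\<close>
definition nabla_along ::
    "('b, 'f::euclidean_space) chart set \<Rightarrow> ('b \<Rightarrow> 'a) \<Rightarrow> ('a, 'e::euclidean_space) christoffel \<Rightarrow>
     ('b, 'f) field \<Rightarrow> ('b, 'a, 'e) field_along \<Rightarrow> ('b, 'a, 'e) field_along" where
  "nabla_along B \<iota> \<Gamma> X W = (\<lambda>a q. dir_deriv B X (W a) q + \<Gamma> a (\<iota> q) (push B \<iota> X a q) (W a q))"

text \<open>The second fundamental form, by the Gauss formula; \<open>\<Gamma>\<close> is the ambient connection and \<open>\<Gamma>M\<close> the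
  connection of the submanifold.\<close>
definition second_ff ::
    "('b, 'f::euclidean_space) chart set \<Rightarrow> ('b \<Rightarrow> 'a) \<Rightarrow> ('a, 'e::euclidean_space) christoffel \<Rightarrow>
     ('b, 'f) christoffel \<Rightarrow> ('b, 'f) field \<Rightarrow> ('b, 'f) field \<Rightarrow> ('b, 'a, 'e) field_along" where
  "second_ff B \<iota> \<Gamma> \<Gamma>M X Y =
     (\<lambda>a q. nabla_along B \<iota> \<Gamma> X (push B \<iota> Y) a q - push B \<iota> (nabla B \<Gamma>M X Y) a q)"

definition nabla_perp ::
    "('b, 'f::euclidean_space) chart set \<Rightarrow> ('b \<Rightarrow> 'a) \<Rightarrow>
     (('a, 'e::euclidean_space) chart \<Rightarrow> 'a \<Rightarrow> 'e \<Rightarrow> 'e \<Rightarrow> real) \<Rightarrow> ('a, 'e) christoffel \<Rightarrow>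
     ('b, 'f) field \<Rightarrow> ('b, 'a, 'e) field_along \<Rightarrow> ('b, 'a, 'e) field_along" where
  "nabla_perp B \<iota> g \<Gamma> X V = (\<lambda>a q. normal_part B \<iota> g a q (nabla_along B \<iota> \<Gamma> X V a q))"

definition normal_curvature ::
    "('b, 'f::euclidean_space) chart set \<Rightarrow> ('b \<Rightarrow> 'a) \<Rightarrow>
     (('a, 'e::euclidean_space) chart \<Rightarrow> 'a \<Rightarrow> 'e \<Rightarrow> 'e \<Rightarrow> real) \<Rightarrow> ('a, 'e) christoffel \<Rightarrow>
     ('b, 'f) field \<Rightarrow> ('b, 'f) field \<Rightarrow> ('b, 'a, 'e) field_along \<Rightarrow> ('b, 'a, 'e) field_along" where
  "normal_curvature B \<iota> g \<Gamma> X Y V = (\<lambda>a q.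
     nabla_perp B \<iota> g \<Gamma> X (nabla_perp B \<iota> g \<Gamma> Y V) a q
       - nabla_perp B \<iota> g \<Gamma> Y (nabla_perp B \<iota> g \<Gamma> X V) a q
       - nabla_perp B \<iota> g \<Gamma> (lie_bracket B X Y) V a q)"

definition invariant_submanifold ::
    "'b topology \<Rightarrow> ('b, 'f::euclidean_space) chart set \<Rightarrow>
     'a topology \<Rightarrow> ('a, 'e::euclidean_space) chart set \<Rightarrow> ('b \<Rightarrow> 'a) \<Rightarrow>
     (('a, 'e) chart \<Rightarrow> 'a \<Rightarrow> 'e \<Rightarrow> 'e) \<Rightarrow> ('a, 'e) field \<Rightarrow> bool" where
  "invariant_submanifold S B T A \<iota> \<phi> \<xi> \<longleftrightarrow>
     immersion S B T A \<iota> \<and>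
     (\<forall>q\<in>topspace S. \<forall>a\<in>A. \<iota> q \<in> chart_dom a \<longrightarrow>
        \<xi> a (\<iota> q) \<in> tangent_space B \<iota> a q \<and>
        \<phi> a (\<iota> q) ` tangent_space B \<iota> a q \<subseteq> tangent_space B \<iota> a q)"

definition totally_geodesic ::
    "'b topology \<Rightarrow> ('b, 'f::euclidean_space) chart set \<Rightarrow>
     ('a, 'e::euclidean_space) chart set \<Rightarrow> ('b \<Rightarrow> 'a) \<Rightarrow>
     ('a, 'e) christoffel \<Rightarrow> ('b, 'f) christoffel \<Rightarrow> bool" where
  "totally_geodesic S B A \<iota> \<Gamma> \<Gamma>M \<longleftrightarrow>
     (\<forall>V X Y. smooth_vector_field S B V X \<and> smooth_vector_field S B V Y \<longrightarrow>
        (\<forall>q\<in>V. \<forall>a\<in>A. \<iota> q \<in> chart_dom a \<longrightarrow> second_ff B \<iota> \<Gamma> \<Gamma>M X Y a q = 0))"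

definition semiparallel ::
    "'b topology \<Rightarrow> ('b, 'f::euclidean_space) chart set \<Rightarrow>
     ('a, 'e::euclidean_space) chart set \<Rightarrow> ('b \<Rightarrow> 'a) \<Rightarrow>
     (('a, 'e) chart \<Rightarrow> 'a \<Rightarrow> 'e \<Rightarrow> 'e \<Rightarrow> real) \<Rightarrow>
     ('a, 'e) christoffel \<Rightarrow> ('b, 'f) christoffel \<Rightarrow> bool" where
  "semiparallel S B A \<iota> g \<Gamma> \<Gamma>M \<longleftrightarrow>
     (\<forall>V X Y Z U. smooth_vector_field S B V X \<and> smooth_vector_field S B V Y \<and>
          smooth_vector_field S B V Z \<and> smooth_vector_field S B V U \<longrightarrow>
        (\<forall>q\<in>V. \<forall>a\<in>A. \<iota> q \<in> chart_dom a \<longrightarrow>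
           normal_curvature B \<iota> g \<Gamma> X Y (second_ff B \<iota> \<Gamma> \<Gamma>M Z U) a q
             - second_ff B \<iota> \<Gamma> \<Gamma>M (curvature B \<Gamma>M X Y Z) U a q
             - second_ff B \<iota> \<Gamma> \<Gamma>M Z (curvature B \<Gamma>M X Y U) a q = 0))"

end

(* For X tangent to M, the ambient derivative of xi along X is -(f1 - f3) phi X, which is tangent to M.
   Hence h(X, xi) = 0, and differentiating once more, with f = f1 - f3,
     R(X, xi) xi = xi(f) phi X + f^2 (X - eta(X) xi).
   Semiparallelity for the arguments X, xi, Z, xi therefore reduces to
     h(Z, xi(f) phi X + f^2 X) = 0.
   Applying this to X and to phi X gives (xi(f)^2 + f^4) h(Z, X) = 0, so h = 0 wherever f is nonzero. *)

theory Submission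
  imports Defs
begin

section \<open>Calculus of \<open>C\<^sup>k\<close> functions\<close>

text \<open>The semiparallelity condition takes vector fields of \<open>M\<close>, whereas \<xi> is
  a field of the ambient manifold. Invariance makes its values along \<open>M\<close> tangent, but
  the field on \<open>M\<close> with these values must also be shown smooth. It solves a linear
  system whose matrix is the Jacobian of the immersion, injective but in general not square; hence
  the results on the regularity of solutions of such systems. The form h is defined as a difference
  in the Gauss formula, so neither its symmetry nor its normality is built in. Symmetry comes from
  second derivatives of the immersion, normality from compatibility of both connections with the
  metrics. For the arguments X, \<xi>, Z, \<xi> two of the three terms vanish: the normal curvature
  acts on h(Z, \<xi>), which is zero on an open set, and h(R(X, \<xi>)Z, \<xi>) = 0. The final
  elimination is complex arithmetic: modulo \<xi>, which h(Z, .) kills, \<phi> is a complex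
  structure, so f^2 + \<xi>(f) \<phi> is multiplication by a complex number, and the conjugate
  factor turns it into the squared modulus. This is why f need not be constant.\<close>

lemma frechet_derivative_eqI:
  "(F has_derivative F') (at x) \<Longrightarrow> frechet_derivative F (at x) = F'"
  by (metis frechet_derivative_at)

text \<open>Holds even where the functions are not differentiable: both sides are the same choice
  from equivalent predicates.\<close>

lemma frechet_derivative_cong:
  assumes "open S" "x \<in> S" "\<And>y. y \<in> S \<Longrightarrow> F y = G y"
  shows "frechet_derivative F (at x) = frechet_derivative G (at x)"
proof -
  have "(F has_derivative F') (at x) \<longleftrightarrow> (G has_derivative F') (at x)" for F'
    using assms by (metis has_derivative_transform_within_open)
  then show ?thesis by (simp add: frechet_derivative_def)
qed

lemma differentiable_cong_open:
  assumes "open S" "x \<in> S" "\<And>y. y \<in> S \<Longrightarrow> F y = G y"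
  shows "F differentiable (at x) \<longleftrightarrow> G differentiable (at x)"
  using assms unfolding differentiable_def by (metis has_derivative_transform_within_open)

lemma Ck_on_cong:
  assumes "open S" "\<And>y. y \<in> S \<Longrightarrow> F y = G y"
  shows "Ck_on k S F \<longleftrightarrow> Ck_on k S G"
  using assms(2)
proof (induction k arbitrary: F G)
  case 0
  then show ?case by (simp cong: continuous_on_cong)
next
  case (Suc k)
  have "Ck_on k S (\<lambda>x. frechet_derivative F (at x) v) \<longleftrightarrow>
        Ck_on k S (\<lambda>x. frechet_derivative G (at x) v)" for v
    by (rule Suc.IH) (metis frechet_derivative_cong[OF \<open>open S\<close>] Suc.prems)
  moreover have "(\<forall>x\<in>S. F differentiable at x) \<longleftrightarrow> (\<forall>x\<in>S. G differentiable at x)"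
    by (metis differentiable_cong_open[OF \<open>open S\<close>] Suc.prems)
  ultimately show ?case by simp
qed

lemma Ck_on_subset: "Ck_on k S F \<Longrightarrow> S' \<subseteq> S \<Longrightarrow> Ck_on k S' F"
  by (induction k arbitrary: F) (auto intro: continuous_on_subset)

text \<open>For a field on the submanifold, regularity is known only on the parts of a chart that a
  single ambient chart covers; this glues them.\<close>

lemma Ck_on_local:
  assumes "\<And>x. x \<in> S \<Longrightarrow> \<exists>U. open U \<and> x \<in> U \<and> Ck_on k U F"
  shows "Ck_on k S F"
  using assms
proof (induction k arbitrary: F)
  case 0
  then have "isCont F x" if "x \<in> S" for x
    using that by (metis Ck_on.simps(1) continuous_on_eq_continuous_at)
  then show ?case by (simp add: continuous_at_imp_continuous_on)
next
  case (Suc k)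
  then have "F differentiable (at x)" if "x \<in> S" for x
    using that by (metis Ck_on.simps(2))
  moreover have "Ck_on k S (\<lambda>x. frechet_derivative F (at x) v)" for v
    by (rule Suc.IH) (use Suc.prems in \<open>metis Ck_on.simps(2)\<close>)
  ultimately show ?case by simp
qed

lemma Ck_on_SucD: "Ck_on (Suc k) S F \<Longrightarrow> Ck_on k S F"
proof (induction k arbitrary: F)
  case 0
  then show ?case
    by (auto intro!: continuous_at_imp_continuous_on differentiable_imp_continuous_within)
qed auto

text \<open>Any explicitly known derivative \<open>D\<close> may replace
  \<open>frechet_derivative\<close>, so inductive steps only exhibit a formula.\<close>

lemma Ck_on_SucI:
  assumes "open S" "\<And>x. x \<in> S \<Longrightarrow> (F has_derivative D x) (at x)" "\<And>v. Ck_on k S (\<lambda>x. D x v)"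
  shows "Ck_on (Suc k) S F"
proof -
  have "Ck_on k S (\<lambda>x. frechet_derivative F (at x) v)" for v
    by (subst Ck_on_cong[OF \<open>open S\<close>, of _ "\<lambda>x. D x v"])
      (use assms frechet_derivative_eqI in \<open>fastforce+\<close>)
  then show ?thesis
    using assms(2) by (auto simp: differentiable_def)
qed

lemma Ck_on_has_derivative:
  "Ck_on (Suc k) S F \<Longrightarrow> x \<in> S \<Longrightarrow> (F has_derivative frechet_derivative F (at x)) (at x)"
  by (simp add: frechet_derivative_works)

lemma Ck_on_const [simp]: "Ck_on k S (\<lambda>x. c)"
  by (induction k arbitrary: c) auto

lemma Ck_on_bounded_linear:
  assumes "bounded_linear L" "open S"
  shows "Ck_on k S F \<Longrightarrow> Ck_on k S (\<lambda>x. L (F x))"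
proof (induction k arbitrary: F)
  case 0
  then show ?case by (simp add: bounded_linear.continuous_on[OF assms(1)])
next
  case (Suc k)
  show ?case
    by (rule Ck_on_SucI[OF \<open>open S\<close>, where D = "\<lambda>x v. L (frechet_derivative F (at x) v)"])
      (use Suc in \<open>auto simp: frechet_derivative_works intro!: bounded_linear.has_derivative[OF assms(1)]\<close>)
qed

lemma Ck_on_add:
  assumes "open S"
  shows "Ck_on k S F \<Longrightarrow> Ck_on k S G \<Longrightarrow> Ck_on k S (\<lambda>x. F x + G x)"
proof (induction k arbitrary: F G)
  case 0
  then show ?case by (simp add: continuous_on_add)
next
  case (Suc k)
  show ?case
    by (rule Ck_on_SucI[OF \<open>open S\<close>,
          where D = "\<lambda>x v. frechet_derivative F (at x) v + frechet_derivative G (at x) v"])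
      (use Suc in \<open>auto simp: frechet_derivative_works intro!: has_derivative_add\<close>)
qed

lemma Ck_on_bounded_bilinear:
  assumes "bounded_bilinear P" "open S"
  shows "Ck_on k S F \<Longrightarrow> Ck_on k S G \<Longrightarrow> Ck_on k S (\<lambda>x. P (F x) (G x))"
proof (induction k arbitrary: F G)
  case 0
  then show ?case by (simp add: bounded_bilinear.continuous_on[OF assms(1)])
next
  case (Suc k)
  note FG = Ck_on_has_derivative[OF Suc.prems(1)] Ck_on_has_derivative[OF Suc.prems(2)]
  show ?case
  proof (rule Ck_on_SucI[OF \<open>open S\<close>])
    show "((\<lambda>x. P (F x) (G x)) has_derivative
        (\<lambda>v. P (F x) (frechet_derivative G (at x) v) + P (frechet_derivative F (at x) v) (G x)))
        (at x)" if "x \<in> S" for x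
      using bounded_bilinear.FDERIV[OF assms(1) FG] that by blast
    show "Ck_on k S (\<lambda>x. P (F x) (frechet_derivative G (at x) v) +
        P (frechet_derivative F (at x) v) (G x))" for v
      by (intro Ck_on_add \<open>open S\<close> Suc.IH) (use Suc.prems Ck_on_SucD in auto)
  qed
qed

lemma Ck_on_sum:
  assumes "open S" "\<And>i. i \<in> I \<Longrightarrow> Ck_on k S (F i)"
  shows "Ck_on k S (\<lambda>x. \<Sum>i\<in>I. F i x)"
  using assms(2)
  by (induction I rule: infinite_finite_induct) (auto intro!: Ck_on_add \<open>open S\<close>)

text \<open>Reduces a family of linear maps to its finitely many columns. Regularity of a family
  \<open>L\<close> can then be expressed as regularity of \<open>\<lambda>x. L x y\<close> for each
  fixed \<open>y\<close>.\<close>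

lemma linear_sum_Basis:
  fixes L :: "'e::euclidean_space \<Rightarrow> 'w::real_vector"
  assumes "linear L"
  shows "L x = (\<Sum>i\<in>Basis. (x \<bullet> i) *\<^sub>R L i)"
proof -
  have "L x = L (\<Sum>i\<in>Basis. (x \<bullet> i) *\<^sub>R i)" by (simp add: euclidean_representation)
  then show ?thesis by (simp add: linear_sum[OF assms] linear_cmul[OF assms])
qed

lemma Ck_on_linear_apply:
  fixes u :: "'e::euclidean_space \<Rightarrow> 'd::euclidean_space"
  assumes "open S" "\<And>x. x \<in> S \<Longrightarrow> linear (L x)" "\<And>y. Ck_on k S (\<lambda>x. L x y)" "Ck_on k S u"
  shows "Ck_on k S (\<lambda>x. L x (u x))"
proof -
  have "Ck_on k S (\<lambda>x. \<Sum>i\<in>Basis. (u x \<bullet> i) *\<^sub>R L x i)"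
    by (intro Ck_on_sum Ck_on_bounded_bilinear[OF bounded_bilinear_scaleR]
        Ck_on_bounded_linear[OF bounded_linear_inner_left] assms)
  then show ?thesis
    by (rule Ck_on_cong[OF \<open>open S\<close>, THEN iffD1, rotated])
      (simp add: linear_sum_Basis[OF assms(2), symmetric])
qed

text \<open>By the chain rule the derivative is a linear family, evaluated along \<open>G\<close>,
  applied to a moving vector. \<open>Ck_on_linear_apply\<close> handles this product, and the
  induction hypothesis applies to each column of the family.\<close>

lemma Ck_on_compose:
  fixes G :: "'e::euclidean_space \<Rightarrow> 'd::euclidean_space"
  assumes "open S" "open S'"
  shows "Ck_on k S' F \<Longrightarrow> Ck_on k S G \<Longrightarrow> G ` S \<subseteq> S' \<Longrightarrow> Ck_on k S (\<lambda>x. F (G x))"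
proof (induction k arbitrary: F)
  case 0
  then show ?case using continuous_on_compose2[of S' F S G] by simp
next
  case (Suc k)
  note F = Ck_on_has_derivative[OF Suc.prems(1)]
  note G = Ck_on_has_derivative[OF Suc.prems(2)]
  show ?case
  proof (rule Ck_on_SucI[OF \<open>open S\<close>])
    show "((\<lambda>x. F (G x)) has_derivative
        (\<lambda>v. frechet_derivative F (at (G x)) (frechet_derivative G (at x) v))) (at x)"
      if "x \<in> S" for x
      using has_derivative_compose[OF G F] that Suc.prems(3) by auto
    show "Ck_on k S (\<lambda>x. frechet_derivative F (at (G x)) (frechet_derivative G (at x) v))" for v
    proof (rule Ck_on_linear_apply[OF \<open>open S\<close>, where L = "\<lambda>x. frechet_derivative F (at (G x))"])
      show "linear (frechet_derivative F (at (G x)))" if "x \<in> S" for x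
        using F[of "G x"] that Suc.prems(3) has_derivative_linear by blast
      show "Ck_on k S (\<lambda>x. frechet_derivative F (at (G x)) y)" for y
        by (rule Suc.IH[OF _ Ck_on_SucD]) (use Suc.prems in auto)
    qed (use Suc.prems in auto)
  qed
qed

section \<open>Linear equations with coefficients depending on a parameter\<close>

text \<open>The identities expressing linearity of \<open>L x\<close> may be differentiated in
  \<open>x\<close>, and derivatives are unique.\<close>

lemma linear_family_derivative:
  fixes L :: "'e::real_normed_vector \<Rightarrow> 'd::real_vector \<Rightarrow> 'w::real_normed_vector"
  assumes "open S" "x \<in> S" "\<And>x. x \<in> S \<Longrightarrow> linear (L x)"
    and L': "\<And>y. ((\<lambda>x. L x y) has_derivative (\<lambda>v. L' v y)) (at x)"
  shows "linear (L' v)"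
proof (rule linearI)
  have "((\<lambda>z. L z (a + b)) has_derivative (\<lambda>v. L' v a + L' v b)) (at x)" for a b
    by (rule has_derivative_transform_within_open[OF has_derivative_add[OF L' L'] assms(1,2)])
      (simp add: assms(3) linear_add)
  then show "L' v (a + b) = L' v a + L' v b" for a b
    using has_derivative_unique[OF L'] by metis
  have "((\<lambda>z. L z (r *\<^sub>R a)) has_derivative (\<lambda>v. r *\<^sub>R L' v a)) (at x)" for r a
    by (rule has_derivative_transform_within_open[OF has_derivative_scaleR_right[OF L'] assms(1,2)])
      (simp add: assms(3) linear_cmul)
  then show "L' v (r *\<^sub>R a) = r *\<^sub>R L' v a" for r a
    using has_derivative_unique[OF L'] by metis
qed

lemma has_derivative_linear_apply:
  fixes u :: "'e::real_normed_vector \<Rightarrow> 'd::euclidean_space"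
    and L :: "'e \<Rightarrow> 'd \<Rightarrow> 'w::real_normed_vector"
  assumes "open S" "x \<in> S" "\<And>x. x \<in> S \<Longrightarrow> linear (L x)"
    and L': "\<And>y. ((\<lambda>x. L x y) has_derivative (\<lambda>v. L' v y)) (at x)"
    and u': "(u has_derivative u') (at x)"
  shows "((\<lambda>x. L x (u x)) has_derivative (\<lambda>v. L' v (u x) + L x (u' v))) (at x)"
proof -
  have lin: "linear (L' v)" for v
    by (rule linear_family_derivative[OF assms(1-3) L'])
  have "((\<lambda>x. \<Sum>i\<in>Basis. (u x \<bullet> i) *\<^sub>R L x i) has_derivative
      (\<lambda>v. \<Sum>i\<in>Basis. (u x \<bullet> i) *\<^sub>R L' v i + (u' v \<bullet> i) *\<^sub>R L x i)) (at x)"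
    by (intro has_derivative_sum has_derivative_scaleR has_derivative_inner_left u' L')
  moreover have "(\<Sum>i\<in>Basis. (u x \<bullet> i) *\<^sub>R L' v i + (u' v \<bullet> i) *\<^sub>R L x i) =
      L' v (u x) + L x (u' v)" for v
    using linear_sum_Basis[OF lin, of v "u x"] linear_sum_Basis[OF assms(3)[OF \<open>x \<in> S\<close>], of "u' v"]
    by (simp add: sum.distrib)
  ultimately have "((\<lambda>x. \<Sum>i\<in>Basis. (u x \<bullet> i) *\<^sub>R L x i) has_derivative
      (\<lambda>v. L' v (u x) + L x (u' v))) (at x)" by simp
  then show ?thesis
    by (rule has_derivative_transform_within_open[OF _ assms(1,2)])
      (simp add: linear_sum_Basis[OF assms(3), symmetric])
qed

text \<open>Injectivity is uniform near \<open>x\<^sub>0\<close>, because all columns are continuous.\<close>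
lemma linear_family_bounded_below:
  fixes L :: "'e::metric_space \<Rightarrow> 'd::euclidean_space \<Rightarrow> 'd"
  assumes "open S" "x0 \<in> S" "\<And>x. x \<in> S \<Longrightarrow> linear (L x)" "inj (L x0)"
    and "\<And>y. continuous (at x0) (\<lambda>x. L x y)"
  obtains e where "e > 0" "\<forall>\<^sub>F x in nhds x0. \<forall>v. e * norm v \<le> norm (L x v)"
proof -
  obtain e where e: "e > 0" "\<And>v. e * norm v \<le> norm (L x0 v)"
    using linear_inj_bounded_below_pos assms(2,3,4) by blast
  have cont: "((\<lambda>x. L x y) \<longlongrightarrow> L x0 y) (nhds x0)" for y
    using assms(5)[of y] tendsto_at_iff_tendsto_nhds[of "\<lambda>x. L x y" x0] by (simp add: continuous_at)
  \<comment> \<open>\<open>r x\<close> dominates the operator norm of \<open>L x - L x0\<close>,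
    since coordinates of a vector are bounded by its norm. Once \<open>r x\<close> is below
    \<open>e / 2\<close>, half of the lower bound at \<open>x0\<close> survives.\<close>
  define r where "r = (\<lambda>x. \<Sum>i\<in>Basis. norm (L x i - L x0 i))"
  have "(r \<longlongrightarrow> (\<Sum>i\<in>(Basis::'d set). norm (L x0 i - L x0 i))) (nhds x0)"
    unfolding r_def
    by (intro tendsto_sum tendsto_norm tendsto_diff tendsto_const cont)
  then have "\<forall>\<^sub>F x in nhds x0. r x < e / 2"
    using e(1) by (auto dest!: order_tendstoD(2)[of _ _ _ "e / 2"])
  moreover have "\<forall>\<^sub>F x in nhds x0. x \<in> S"
    using assms(1,2) by (simp add: eventually_nhds_in_open)
  ultimately have "\<forall>\<^sub>F x in nhds x0. \<forall>v. e / 2 * norm v \<le> norm (L x v)"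
  proof eventually_elim
    case (elim x)
    show ?case
    proof
      fix v
      have "L x0 v - L x v = (\<Sum>i\<in>Basis. (v \<bullet> i) *\<^sub>R (L x0 i - L x i))"
        using linear_sum_Basis[OF assms(3), of x0 v] linear_sum_Basis[OF assms(3), of x v] elim assms(2)
        by (simp add: sum_subtractf scaleR_diff_right)
      also have "norm \<dots> \<le> (\<Sum>i\<in>Basis. norm v * norm (L x i - L x0 i))"
        by (rule sum_norm_le) (simp add: mult_right_mono Basis_le_norm norm_minus_commute)
      also have "\<dots> = r x * norm v" by (simp add: r_def sum_distrib_left sum_distrib_right mult.commute)
      also have "\<dots> \<le> e / 2 * norm v" using elim(1) by (intro mult_right_mono) auto
      finally have "norm (L x0 v - L x v) \<le> e / 2 * norm v" .
      moreover have "norm (L x0 v) \<le> norm (L x0 v - L x v) + norm (L x v)"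
        using norm_triangle_sub[of "L x0 v" "L x v"] by simp
      ultimately show "e / 2 * norm v \<le> norm (L x v)" using e(2)[of v] by simp
    qed
  qed
  then show ?thesis using that[of "e / 2"] e(1) by simp
qed

text \<open>The candidate \<open>u'\<close> comes from differentiating
  \<open>L x (u x) = s x\<close> formally. The affine function \<open>w\<close> with this slope
  satisfies the equation up to a residual \<open>\<rho>\<close> that vanishes to first order at
  \<open>x0\<close>, and the uniform lower bound on \<open>L x\<close> turns the residual into a
  bound for \<open>u - w\<close>.\<close>

lemma has_derivative_solve:
  fixes L :: "'e::real_normed_vector \<Rightarrow> 'd::euclidean_space \<Rightarrow> 'd"
  assumes S: "open S" "x0 \<in> S" "\<And>x. x \<in> S \<Longrightarrow> linear (L x)" "inj (L x0)"
    and L': "\<And>y. ((\<lambda>x. L x y) has_derivative (\<lambda>v. L' v y)) (at x0)"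
    and s': "(s has_derivative s') (at x0)"
    and sol: "\<And>x. x \<in> S \<Longrightarrow> L x (u x) = s x"
    and u': "\<And>v. L x0 (u' v) = s' v - L' v (u x0)"
  shows "(u has_derivative u') (at x0)"
proof -
  obtain e where e: "e > 0" "\<forall>\<^sub>F x in nhds x0. \<forall>v. e * norm v \<le> norm (L x v)"
    by (rule linear_family_bounded_below[of S x0 L]) (use S has_derivative_continuous[OF L'] in auto)
  have inj: "linear (L x0)" using S by blast
  interpret L0: linear "L x0" by fact
  have lin_rhs: "linear (\<lambda>v. s' v - L' v (u x0))"
    using has_derivative_linear[OF has_derivative_diff[OF s' L']] .
  \<comment> \<open>Only the images under \<open>L x0\<close> of the values of \<open>u'\<close> are
    known; injectivity transfers linearity from the right-hand side.\<close>
  have "linear u'"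
  proof (rule linearI)
    show "u' (a + b) = u' a + u' b" for a b
      by (rule injD[OF S(4)]) (simp only: L0.add u' linear_add[OF lin_rhs])
    show "u' (r *\<^sub>R a) = r *\<^sub>R u' a" for r a
      by (rule injD[OF S(4)]) (simp only: L0.scaleR u' linear_cmul[OF lin_rhs])
  qed
  have bl_rhs: "bounded_linear (\<lambda>v. s' v - L' v (u x0))"
    using has_derivative_bounded_linear[OF has_derivative_diff[OF s' L']] .
  have bl: "bounded_linear u'"
  proof -
    obtain K where K: "\<And>v. norm (s' v - L' v (u x0)) \<le> norm v * K"
      using bounded_linear.bounded[OF bl_rhs] by blast
    obtain d where d: "d > 0" "\<And>v. d * norm v \<le> norm (L x0 v)"
      using linear_inj_bounded_below_pos[OF inj S(4)] by blast
    have "norm (u' v) \<le> norm v * (K / d)" for v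
      using d(2)[of "u' v"] K[of v] d(1) by (simp add: u' field_simps)
    then show ?thesis
      by (rule bounded_linear_intro[OF linear_add[OF \<open>linear u'\<close>] linear_cmul[OF \<open>linear u'\<close>]])
  qed
  define w where "w = (\<lambda>x. u x0 + u' (x - x0))"
  define \<rho> where "\<rho> = (\<lambda>x. s x - L x (w x))"
  have w': "(w has_derivative u') (at x0)"
    unfolding w_def by (auto intro!: derivative_eq_intros bounded_linear.has_derivative[OF bl])
  have w0: "w x0 = u x0"
    using linear_0[OF \<open>linear u'\<close>] by (simp add: w_def)
  have "(\<rho> has_derivative (\<lambda>v. s' v - (L' v (w x0) + L x0 (u' v)))) (at x0)"
    unfolding \<rho>_def by (intro has_derivative_diff s' has_derivative_linear_apply[OF S(1-3) L' w'])
  then have \<rho>': "(\<rho> has_derivative (\<lambda>v. 0)) (at x0)" by (simp add: w0 u')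
  have \<rho>0: "\<rho> x0 = 0" using sol S(2) by (simp add: \<rho>_def w0)
  have est: "\<forall>\<^sub>F x in nhds x0. norm (u x - w x) \<le> norm (\<rho> x) / e"
    using e(2) eventually_nhds_in_open[OF S(1,2)]
  proof eventually_elim
    case (elim x)
    have "L x (u x - w x) = \<rho> x"
      using elim(2) by (simp add: \<rho>_def linear_diff[OF S(3)] sol)
    then show ?case using elim(1)[rule_format, of "u x - w x"] e(1) by (simp add: field_simps)
  qed
  show ?thesis
    unfolding has_derivative_at_alt
  proof (intro conjI bl allI impI)
    fix c :: real assume "c > 0"
    then have "c * e > 0" using e(1) by simp
    then obtain d where d: "d > 0" "\<And>y. norm (y - x0) < d \<Longrightarrow> norm (\<rho> y) \<le> c * e * norm (y - x0)"
      using \<rho>' \<rho>0 unfolding has_derivative_at_alt by force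
    obtain d' where d': "d' > 0" "\<And>y. dist y x0 < d' \<Longrightarrow> norm (u y - w y) \<le> norm (\<rho> y) / e"
      using est unfolding eventually_nhds_metric by blast
    have "norm (u y - u x0 - u' (y - x0)) \<le> c * norm (y - x0)" if "norm (y - x0) < min d d'" for y
    proof -
      have "norm (u y - w y) \<le> norm (\<rho> y) / e" using d'(2) that by (simp add: dist_norm)
      also have "\<dots> \<le> c * norm (y - x0)" using d(2)[of y] that e(1) by (simp add: field_simps)
      finally show ?thesis by (simp add: w_def algebra_simps)
    qed
    then show "\<exists>d>0. \<forall>y. norm (y - x0) < d \<longrightarrow> norm (u y - u x0 - u' (y - x0)) \<le> c * norm (y - x0)"
      using d(1) d'(1) by (intro exI[of _ "min d d'"]) auto
  qed
qed

text \<open>Differentiating \<open>L u = s\<close> shows that \<open>u'\<close> solves the equation with right-hand side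
  \<open>s' - L' u\<close>, which is as regular as \<open>u\<close> is already known to be.\<close>
lemma Ck_on_solve:
  fixes L :: "'e::euclidean_space \<Rightarrow> 'd::euclidean_space \<Rightarrow> 'd"
  assumes S: "open S" "\<And>x. x \<in> S \<Longrightarrow> linear (L x)" "\<And>x. x \<in> S \<Longrightarrow> inj (L x)"
    and smooth: "\<And>k y. Ck_on k S (\<lambda>x. L x y)"
  shows "Ck_on k S s \<Longrightarrow> (\<And>x. x \<in> S \<Longrightarrow> L x (u x) = s x) \<Longrightarrow> Ck_on k S u"
proof (induction k arbitrary: s u)
  case 0
  have "isCont u x0" if x0: "x0 \<in> S" for x0
  proof -
    have cL: "isCont (\<lambda>x. L x y) x0" for y
      using smooth[of 0 y] S(1) that by (simp add: continuous_on_eq_continuous_at)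
    have cs: "isCont s x0"
      using 0(1) S(1) that by (simp add: continuous_on_eq_continuous_at)
    obtain e where e: "e > 0" "\<forall>\<^sub>F x in nhds x0. \<forall>v. e * norm v \<le> norm (L x v)"
      by (rule linear_family_bounded_below[of S x0 L, OF S(1) x0 S(2) S(3)[OF x0]]) (use cL in auto)
    have "\<forall>\<^sub>F x in nhds x0. norm (u x - u x0) \<le> norm (s x - L x (u x0)) / e"
      using e(2) eventually_nhds_in_open[OF S(1) that]
    proof eventually_elim
      case (elim x)
      have L_eq: "L x (u x - u x0) = s x - L x (u x0)"
        using elim(2) by (simp add: linear_diff[OF S(2)] 0)
      have "e * norm (u x - u x0) \<le> norm (s x - L x (u x0))"
        using elim(1) unfolding L_eq[symmetric] by blast
      then show ?case using e(1) by (simp add: mult.commute pos_le_divide_eq)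
    qed
    then have "\<forall>\<^sub>F x in at x0. norm (u x - u x0) \<le> norm (s x - L x (u x0)) / e"
      by (simp add: eventually_nhds_conv_at)
    moreover have "((\<lambda>x. norm (s x - L x (u x0)) / e) \<longlongrightarrow> 0) (at x0)"
    proof -
      have "((\<lambda>x. norm (s x - L x (u x0)) / e) \<longlongrightarrow> norm (s x0 - L x0 (u x0)) / e) (at x0)"
        using cs cL e(1) by (intro tendsto_intros) (auto simp: continuous_at)
      then show ?thesis using 0(2)[OF that] by simp
    qed
    ultimately have "((\<lambda>x. u x - u x0) \<longlongrightarrow> 0) (at x0)"
      by (rule Lim_null_comparison)
    then show ?thesis unfolding continuous_at by (rule LIM_zero_cancel)
  qed
  then show ?case by (simp add: continuous_at_imp_continuous_on)
next
  case (Suc k)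
  let ?D = "frechet_derivative"
  \<comment> \<open>The induction hypothesis is used twice: here for the original system at lower
    regularity, so that the differentiated right-hand side is of class k, and later for the
    differentiated system itself.\<close>
  have u: "Ck_on k S u" by (rule Suc.IH[OF Ck_on_SucD[OF Suc.prems(1)] Suc.prems(2)])
  have L': "((\<lambda>x. L x y) has_derivative ?D (\<lambda>x. L x y) (at x)) (at x)" if "x \<in> S" for x y
    by (rule Ck_on_has_derivative[OF smooth that])
  \<comment> \<open>An injective linear map from a finite-dimensional space to itself is onto, so
    \<open>inv (L x)\<close> does solve the differentiated equation.\<close>
  define u' where "u' = (\<lambda>x v. inv (L x) (?D s (at x) v - ?D (\<lambda>z. L z (u x)) (at x) v))"
  have Lu': "L x (u' x v) = ?D s (at x) v - ?D (\<lambda>z. L z (u x)) (at x) v" if "x \<in> S" for x v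
    unfolding u'_def
    by (rule surj_f_inv_f[OF linear_injective_imp_surjective[OF S(2) S(3)]]) (use that in auto)
  have L'_lin: "linear (\<lambda>y. ?D (\<lambda>z. L z y) (at x) v)" if "x \<in> S" for x v
    by (rule linear_family_derivative[OF S(1) that S(2) L'[OF that]])
  show ?case
  proof (rule Ck_on_SucI[OF S(1)])
    show "(u has_derivative u' x) (at x)" if "x \<in> S" for x
      by (rule has_derivative_solve[OF S(1) that S(2) S(3)[OF that] L'[OF that]
            Ck_on_has_derivative[OF Suc.prems(1) that] Suc.prems(2) Lu'[OF that]])
    show "Ck_on k S (\<lambda>x. u' x v)" for v
    proof (rule Suc.IH[OF _ Lu'])
      have "Ck_on k S (\<lambda>x. ?D (\<lambda>z. L z (u x)) (at x) v)"
        by (rule Ck_on_linear_apply[OF S(1) L'_lin _ u]) (use smooth[of "Suc k"] in auto)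
      then have "Ck_on k S (\<lambda>x. ?D s (at x) v + - ?D (\<lambda>z. L z (u x)) (at x) v)"
        by (intro Ck_on_add S(1) Ck_on_bounded_linear[OF bounded_linear_minus[OF bounded_linear_ident]])
          (use Suc.prems in auto)
      then show "Ck_on k S (\<lambda>x. ?D s (at x) v - ?D (\<lambda>z. L z (u x)) (at x) v)" by simp
    qed
  qed
qed

text \<open>An overdetermined system with injective coefficients is reduced to the square case by passing to
  the normal equations.\<close>
lemma Ck_on_solve_injective:
  fixes L :: "'e::euclidean_space \<Rightarrow> 'd::euclidean_space \<Rightarrow> 'w::euclidean_space"
  assumes S: "open S" "\<And>x. x \<in> S \<Longrightarrow> linear (L x)" "\<And>x. x \<in> S \<Longrightarrow> inj (L x)"
    and smooth: "\<And>k y. Ck_on k S (\<lambda>x. L x y)"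
    and s: "Ck_on k S s" and sol: "\<And>x. x \<in> S \<Longrightarrow> L x (u x) = s x"
  shows "Ck_on k S u"
proof -
  \<comment> \<open>\<open>P w x\<close> is the transpose of \<open>L x\<close> applied to
    \<open>w x\<close>; thus \<open>?G x\<close> below is the Gram operator of
    \<open>L x\<close>.\<close>
  define P :: "('e \<Rightarrow> 'w) \<Rightarrow> 'e \<Rightarrow> 'd" where "P w x = (\<Sum>i\<in>Basis. (w x \<bullet> L x i) *\<^sub>R i)" for w x
  have P_smooth: "Ck_on k S (P w)" if "Ck_on k S w" for k w
    unfolding P_def[abs_def]
    by (intro Ck_on_sum[OF S(1)] Ck_on_bounded_linear[OF bounded_linear_scaleR_left S(1)]
        Ck_on_bounded_bilinear[OF bounded_bilinear_inner S(1) that smooth])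
  have P_inner: "P w x \<bullet> y = w x \<bullet> L x y" if "x \<in> S" for w x y
  proof -
    have "P w x \<bullet> y = (\<Sum>i\<in>Basis. (w x \<bullet> L x i) * (y \<bullet> i))"
      by (simp add: P_def inner_sum_left inner_commute[of y])
    also have "\<dots> = w x \<bullet> (\<Sum>i\<in>Basis. (y \<bullet> i) *\<^sub>R L x i)"
      by (simp add: inner_sum_right mult.commute)
    finally show ?thesis using linear_sum_Basis[OF S(2)[OF that], of y] by simp
  qed
  let ?G = "\<lambda>x y. P (\<lambda>x. L x y) x"
  show ?thesis
  proof (rule Ck_on_solve[OF S(1), where L = ?G])
    show lin: "linear (?G x)" if "x \<in> S" for x
    proof (rule linearI)
      show "?G x (a + b) = ?G x a + ?G x b" for a b
        by (simp add: P_def linear_add[OF S(2)[OF that]] inner_add_left scaleR_add_left sum.distrib)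
      show "?G x (r *\<^sub>R a) = r *\<^sub>R ?G x a" for r a
        by (simp add: P_def linear_cmul[OF S(2)[OF that]] scaleR_sum_right)
    qed
    \<comment> \<open>Pairing \<open>?G x y\<close> with \<open>y\<close> gives the squared norm of
      \<open>L x y\<close>, so the kernel of the Gram operator is that of
      \<open>L x\<close>.\<close>
    show "inj (?G x)" if "x \<in> S" for x
    proof -
      have "y = 0" if "?G x y = 0" for y
      proof -
        have "L x y \<bullet> L x y = 0" using P_inner[OF \<open>x \<in> S\<close>, of "\<lambda>x. L x y" y] that by simp
        then have "L x y = L x 0" by (simp add: linear_0[OF S(2)[OF \<open>x \<in> S\<close>]])
        then show ?thesis by (rule injD[OF S(3)[OF \<open>x \<in> S\<close>]])
      qed
      then show ?thesis using linear_injective_0[OF lin[OF that]] by blast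
    qed
    show "Ck_on k S (\<lambda>x. ?G x y)" for k y
      by (rule P_smooth[OF smooth])
    show "Ck_on k S (P s)" by (rule P_smooth[OF s])
    show "?G x (u x) = P s x" if "x \<in> S" for x by (simp add: P_def sol[OF that])
  qed
qed

section \<open>Symmetry of second derivatives\<close>

text \<open>The second difference is the change, over a step \<open>t\<close> along
  \<open>u\<close>, of the increment along \<open>v\<close>. The mean value theorem expresses it by
  first derivatives in the direction \<open>u\<close>, which differentiability of
  \<open>\<lambda>y. D y u\<close> at \<open>x\<close> expands to first order.\<close>

lemma second_difference_quotient:
  fixes F :: "'e::real_normed_vector \<Rightarrow> real"
  assumes S: "open S" "x \<in> S" and F': "\<And>y. y \<in> S \<Longrightarrow> (F has_derivative D y) (at y)"
    and Du: "((\<lambda>y. D y u) has_derivative Du) (at x)" and "e > 0"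
  shows "\<exists>d>0. \<forall>t. 0 < t \<and> t < d \<longrightarrow>
    \<bar>F (x + t *\<^sub>R u + t *\<^sub>R v) - F (x + t *\<^sub>R u) - F (x + t *\<^sub>R v) + F x - t\<^sup>2 * Du v\<bar> \<le> e * t\<^sup>2"
proof -
  \<comment> \<open>All points used are at distance at most \<open>t * M\<close> from
    \<open>x\<close>; the summand 1 keeps \<open>M\<close> positive when both directions
    vanish.\<close>
  define M where "M = norm u + norm v + 1"
  have M: "M > 0" unfolding M_def by (simp add: add_nonneg_pos)
  \<comment> \<open>Two errors of size \<open>c * (t * M)\<close> will add up to exactly
    \<open>e * t\<close>.\<close>
  define c where "c = e / (2 * M)"
  have "c > 0" using \<open>e > 0\<close> M by (simp add: c_def)
  interpret Du: bounded_linear Du using Du by (rule has_derivative_bounded_linear)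
  obtain d where d: "d > 0" "\<And>y. norm (y - x) < d \<Longrightarrow> \<bar>D y u - D x u - Du (y - x)\<bar> \<le> c * norm (y - x)"
    using Du \<open>c > 0\<close> unfolding has_derivative_at_alt by (metis real_norm_def)
  obtain r where r: "r > 0" "ball x r \<subseteq> S" using S openE by blast
  have "\<bar>F (x + t *\<^sub>R u + t *\<^sub>R v) - F (x + t *\<^sub>R u) - F (x + t *\<^sub>R v) + F x - t\<^sup>2 * Du v\<bar> \<le> e * t\<^sup>2"
    if t: "0 < t" "t < min d r / M" for t
  proof -
    have tM: "t * M < min d r" using t M by (simp add: field_simps)
    have small: "norm (a *\<^sub>R u + b *\<^sub>R v) \<le> t * M" if "0 \<le> a" "a \<le> t" "0 \<le> b" "b \<le> t" for a b
    proof -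
      have "norm (a *\<^sub>R u + b *\<^sub>R v) \<le> a * norm u + b * norm v"
        using norm_triangle_ineq[of "a *\<^sub>R u" "b *\<^sub>R v"] that by simp
      also have "\<dots> \<le> t * norm u + t * norm v"
        using that by (intro add_mono mult_right_mono) auto
      also have "\<dots> \<le> t * M" using t by (simp add: M_def algebra_simps)
      finally show ?thesis .
    qed
    have inS: "x + a *\<^sub>R u + b *\<^sub>R v \<in> S" if "0 \<le> a" "a \<le> t" "0 \<le> b" "b \<le> t" for a b
    proof -
      have "x + h \<in> S" if "norm h < r" for h
        using r(2) that by (auto simp: subset_iff dist_norm)
      from this[of "a *\<^sub>R u + b *\<^sub>R v"] show ?thesis
        using small[OF that] tM by (simp add: add.assoc)
    qed
    \<comment> \<open>The increment along \<open>v\<close> as a function of the step along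
      \<open>u\<close>. The summand \<open>0 *\<^sub>R v\<close> is written out so that
      \<open>der\<close> and \<open>est\<close> apply with \<open>b = 0\<close> as well as with
      \<open>b = t\<close>.\<close>
    define k where "k = (\<lambda>s. F (x + s *\<^sub>R u + t *\<^sub>R v) - F (x + s *\<^sub>R u + 0 *\<^sub>R v))"
    have der: "((\<lambda>s. F (x + s *\<^sub>R u + b *\<^sub>R v)) has_real_derivative D (x + s *\<^sub>R u + b *\<^sub>R v) u) (at s)"
      if "0 \<le> s" "s \<le> t" "0 \<le> b" "b \<le> t" for s b
    proof -
      note FD = F'[OF inS[OF that]]
      have "((\<lambda>s. x + s *\<^sub>R u + b *\<^sub>R v) has_derivative (\<lambda>h. h *\<^sub>R u)) (at s)"
        by (auto intro!: derivative_eq_intros)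
      note has_derivative_compose[OF this, of F "D (x + s *\<^sub>R u + b *\<^sub>R v)", OF FD]
      moreover have "(\<lambda>h. D (x + s *\<^sub>R u + b *\<^sub>R v) (h *\<^sub>R u)) = (*) (D (x + s *\<^sub>R u + b *\<^sub>R v) u)"
        by (rule ext) (simp add: linear_cmul[OF has_derivative_linear[OF FD]])
      ultimately show ?thesis
        unfolding has_field_derivative_def by (simp only:)
    qed
    have "\<exists>\<sigma>. 0 < \<sigma> \<and> \<sigma> < t \<and>
        k t - k 0 = (t - 0) * (D (x + \<sigma> *\<^sub>R u + t *\<^sub>R v) u - D (x + \<sigma> *\<^sub>R u + 0 *\<^sub>R v) u)"
      unfolding k_def using t by (intro MVT2 DERIV_diff der) auto
    then obtain \<sigma> where \<sigma>: "0 < \<sigma>" "\<sigma> < t"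
      "k t - k 0 = t * (D (x + \<sigma> *\<^sub>R u + t *\<^sub>R v) u - D (x + \<sigma> *\<^sub>R u + 0 *\<^sub>R v) u)"
      by auto
    have est: "\<bar>D (x + \<sigma> *\<^sub>R u + b *\<^sub>R v) u - D x u - (\<sigma> * Du u + b * Du v)\<bar> \<le> c * (t * M)"
      if "0 \<le> b" "b \<le> t" for b
    proof -
      let ?y = "x + \<sigma> *\<^sub>R u + b *\<^sub>R v"
      have y: "?y - x = \<sigma> *\<^sub>R u + b *\<^sub>R v" by simp
      have le: "norm (?y - x) \<le> t * M" using small[of \<sigma> b] \<sigma> that unfolding y by simp
      then have "\<bar>D ?y u - D x u - Du (?y - x)\<bar> \<le> c * norm (?y - x)"
        using tM by (intro d(2)) simp
      also have "\<dots> \<le> c * (t * M)" using le \<open>c > 0\<close> by simp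
      finally show ?thesis unfolding y by (simp add: Du.add Du.scaleR)
    qed
    have "\<bar>(D (x + \<sigma> *\<^sub>R u + t *\<^sub>R v) u - D (x + \<sigma> *\<^sub>R u + 0 *\<^sub>R v) u) - t * Du v\<bar> \<le> 2 * (c * (t * M))"
      using est[OF less_imp_le[OF t(1)] order.refl] est[OF order.refl less_imp_le[OF t(1)]] by linarith
    also have "2 * (c * (t * M)) = e * t" using M by (simp add: c_def)
    finally have "\<bar>t * ((D (x + \<sigma> *\<^sub>R u + t *\<^sub>R v) u - D (x + \<sigma> *\<^sub>R u + 0 *\<^sub>R v) u) - t * Du v)\<bar> \<le> t * (e * t)"
      using t by (simp add: abs_mult)
    then have "\<bar>k t - k 0 - t\<^sup>2 * Du v\<bar> \<le> e * t\<^sup>2"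
      unfolding \<sigma>(3) by (simp add: algebra_simps power2_eq_square)
    then show ?thesis by (simp add: k_def algebra_simps)
  qed
  then show ?thesis using d(1) r(1) M by (intro exI[of _ "min d r / M"]) auto
qed

text \<open>The second difference is symmetric in \<open>u\<close> and \<open>v\<close>, so both
  numbers approximate the same quotient by \<open>t\<^sup>2\<close>, each with error at most
  \<open>e\<close>.\<close>

lemma second_derivative_symmetric_real:
  fixes F :: "'e::real_normed_vector \<Rightarrow> real"
  assumes S: "open S" "x \<in> S" and F': "\<And>y. y \<in> S \<Longrightarrow> (F has_derivative D y) (at y)"
    and Du: "((\<lambda>y. D y u) has_derivative Du) (at x)"
    and Dv: "((\<lambda>y. D y v) has_derivative Dv) (at x)"
  shows "Du v = Dv u"
proof -
  have "\<bar>Du v - Dv u\<bar> \<le> 2 * e" if e: "e > 0" for e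
  proof -
    obtain d1 where d1: "d1 > 0" "\<And>t. 0 < t \<and> t < d1 \<Longrightarrow>
        \<bar>F (x + t *\<^sub>R u + t *\<^sub>R v) - F (x + t *\<^sub>R u) - F (x + t *\<^sub>R v) + F x - t\<^sup>2 * Du v\<bar> \<le> e * t\<^sup>2"
      using second_difference_quotient[OF S F' Du e] by blast
    obtain d2 where d2: "d2 > 0" "\<And>t. 0 < t \<and> t < d2 \<Longrightarrow>
        \<bar>F (x + t *\<^sub>R v + t *\<^sub>R u) - F (x + t *\<^sub>R v) - F (x + t *\<^sub>R u) + F x - t\<^sup>2 * Dv u\<bar> \<le> e * t\<^sup>2"
      using second_difference_quotient[OF S F' Dv e] by blast
    define t where "t = min d1 d2 / 2"
    have t: "0 < t" "t < d1" "t < d2" using d1(1) d2(1) by (auto simp: t_def)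
    have swap: "x + t *\<^sub>R v + t *\<^sub>R u = x + t *\<^sub>R u + t *\<^sub>R v" by (simp add: ac_simps)
    have "\<bar>t\<^sup>2 * Du v - t\<^sup>2 * Dv u\<bar> \<le> e * t\<^sup>2 + e * t\<^sup>2"
      using d1(2)[OF conjI[OF t(1,2)]] d2(2)[OF conjI[OF t(1,3)], unfolded swap] by linarith
    then have "\<bar>t\<^sup>2 * (Du v - Dv u)\<bar> \<le> t\<^sup>2 * (2 * e)" by (simp add: algebra_simps)
    then have "t\<^sup>2 * \<bar>Du v - Dv u\<bar> \<le> t\<^sup>2 * (2 * e)" unfolding abs_mult by simp
    then show ?thesis using t(1) by simp
  qed
  \<comment> \<open>With \<open>e\<close> a quarter of the distance, the bound says that the
    distance is at most half of itself.\<close>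
  from this[of "\<bar>Du v - Dv u\<bar> / 4"] show ?thesis by (cases "Du v = Dv u") auto
qed

lemma second_derivative_symmetric:
  fixes F :: "'e::euclidean_space \<Rightarrow> 'w::euclidean_space"
  assumes S: "open S" "x \<in> S" and F: "\<And>k. Ck_on k S F"
  shows "frechet_derivative (\<lambda>y. frechet_derivative F (at y) u) (at x) v =
         frechet_derivative (\<lambda>y. frechet_derivative F (at y) v) (at x) u"
proof (rule euclidean_eqI)
  fix i :: 'w assume "i \<in> Basis"
  have "((\<lambda>y. frechet_derivative F (at y) w) has_derivative
      frechet_derivative (\<lambda>y. frechet_derivative F (at y) w) (at x)) (at x)" for w
    using F[of "Suc (Suc 0)"] S(2) by (simp add: frechet_derivative_works)
  moreover have "(F has_derivative frechet_derivative F (at y)) (at y)" if "y \<in> S" for y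
    by (rule Ck_on_has_derivative[OF F that])
  ultimately show "frechet_derivative (\<lambda>y. frechet_derivative F (at y) u) (at x) v \<bullet> i =
      frechet_derivative (\<lambda>y. frechet_derivative F (at y) v) (at x) u \<bullet> i"
    using second_derivative_symmetric_real[OF S, of "\<lambda>y. F y \<bullet> i"
        "\<lambda>y w. frechet_derivative F (at y) w \<bullet> i"] has_derivative_inner_left by blast
qed

section \<open>Calculus in charts\<close>

text \<open>\<open>chart_deriv\<close> has an unspecified value where \<open>F\<close> is not
  differentiable in the chart; this predicate is its guard.\<close>

definition chart_diff :: "('a, 'e::euclidean_space) chart \<Rightarrow> ('a \<Rightarrow> 'w::real_normed_vector) \<Rightarrow> 'a \<Rightarrow> bool" where
  "chart_diff c F p \<longleftrightarrow> (F \<circ> chart_inv c) differentiable (at (coord c p))"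

lemma chart_diff_works:
  "chart_diff c F p \<longleftrightarrow> ((F \<circ> chart_inv c) has_derivative chart_deriv c F p) (at (coord c p))"
  by (simp add: chart_diff_def chart_deriv_def frechet_derivative_works)

lemma chart_derivI:
  assumes "((F \<circ> chart_inv c) has_derivative D) (at (coord c p))"
  shows "chart_diff c F p" "chart_deriv c F p = D"
  using assms by (auto simp: chart_diff_def chart_deriv_def differentiable_def frechet_derivative_eqI)

lemma linear_chart_deriv: "chart_diff c F p \<Longrightarrow> linear (chart_deriv c F p)"
  unfolding chart_diff_works by (rule has_derivative_linear)

lemma chart_diff_const [simp]: "chart_diff c (\<lambda>p. k) p"
  and chart_deriv_const [simp]: "chart_deriv c (\<lambda>p. k) p = (\<lambda>v. 0)"
  using chart_derivI[of "\<lambda>p. k" c "\<lambda>v. 0" p] by (simp_all add: comp_def)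

lemma chart_diff_minus:
  assumes "chart_diff c F p" "chart_diff c G p"
  shows "chart_diff c (\<lambda>p. F p - G p) p"
    "chart_deriv c (\<lambda>p. F p - G p) p v = chart_deriv c F p v - chart_deriv c G p v"
proof -
  have "((\<lambda>p. F p - G p) \<circ> chart_inv c has_derivative (\<lambda>v. chart_deriv c F p v - chart_deriv c G p v))
      (at (coord c p))"
    using has_derivative_diff[OF assms[unfolded chart_diff_works]] by (simp add: comp_def)
  from chart_derivI[OF this] show "chart_diff c (\<lambda>p. F p - G p) p"
    "chart_deriv c (\<lambda>p. F p - G p) p v = chart_deriv c F p v - chart_deriv c G p v" by auto
qed

lemma bilinear_left: "bilinear P \<Longrightarrow> linear (\<lambda>x. P x y)"
  and bilinear_right: "bilinear P \<Longrightarrow> linear (P x)"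
  by (auto simp: bilinear_def)

lemma has_derivative_transform_nhds:
  assumes "\<forall>\<^sub>F u in nhds x. F u = G u"
  shows "(F has_derivative D) (at x) \<longleftrightarrow> (G has_derivative D) (at x)"
proof -
  obtain S where S: "open S" "x \<in> S" "\<And>u. u \<in> S \<Longrightarrow> F u = G u"
    using assms by (auto simp: eventually_nhds)
  show ?thesis
    using has_derivative_transform_within_open[of F D x UNIV S G]
      has_derivative_transform_within_open[of G D x UNIV S F] S by auto
qed

locale smooth_mfd =
  fixes T :: "'a topology" and A :: "('a, 'e::euclidean_space) chart set"
  assumes mfd: "smooth_manifold T A"
begin

lemma openin_chart: "c \<in> A \<Longrightarrow> openin T (chart_dom c)"
  using mfd unfolding smooth_manifold_def by blast

lemma chart_at:
  assumes "p \<in> topspace T"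
  shows "chart_at A p \<in> A" "p \<in> chart_dom (chart_at A p)"
proof -
  have "\<exists>c. c \<in> A \<and> p \<in> chart_dom c" using mfd assms unfolding smooth_manifold_def by blast
  then have "chart_at A p \<in> A \<and> p \<in> chart_dom (chart_at A p)"
    unfolding chart_at_def by (rule someI_ex)
  then show "chart_at A p \<in> A" "p \<in> chart_dom (chart_at A p)" by auto
qed

lemma in_topspace: "c \<in> A \<Longrightarrow> p \<in> chart_dom c \<Longrightarrow> p \<in> topspace T"
  by (rule subsetD[OF openin_subset[OF openin_chart]])

lemma topspace_chart: "c \<in> A \<Longrightarrow> topspace (subtopology T (chart_dom c)) = chart_dom c"
  by (simp add: openin_subset[OF openin_chart] Int_absorb1)

lemma homeo: "c \<in> A \<Longrightarrow>
    homeomorphic_map (subtopology T (chart_dom c)) (top_of_set (coord c ` chart_dom c)) (coord c)"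
  using mfd unfolding smooth_manifold_def by blast

lemma inj_on_coord: "c \<in> A \<Longrightarrow> inj_on (coord c) (chart_dom c)"
  using homeomorphic_imp_injective_map[OF homeo] topspace_chart by metis

lemma chart_inv_coord: "c \<in> A \<Longrightarrow> p \<in> chart_dom c \<Longrightarrow> chart_inv c (coord c p) = p"
  by (simp add: chart_inv_def inj_on_coord)

lemma chart_inv_image:
  assumes "c \<in> A" "u \<in> coord c ` W" "W \<subseteq> chart_dom c"
  shows "chart_inv c u \<in> W" "coord c (chart_inv c u) = u"
proof -
  obtain p where p: "p \<in> W" "u = coord c p" using assms(2) by blast
  then have "chart_inv c u = p" using chart_inv_coord[OF assms(1)] assms(3) by blast
  then show "chart_inv c u \<in> W" "coord c (chart_inv c u) = u" using p by simp_all
qed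

lemma open_coord_image:
  assumes "c \<in> A" "openin T W" "W \<subseteq> chart_dom c"
  shows "open (coord c ` W)"
proof -
  have "openin (subtopology T (chart_dom c)) W"
    using assms by (metis openin_subtopology Int_absorb2)
  then have "openin (top_of_set (coord c ` chart_dom c)) (coord c ` W)"
    using homeomorphic_imp_open_map[OF homeo[OF assms(1)]] by (simp add: open_map_def)
  moreover have "open (coord c ` chart_dom c)"
    using mfd assms(1) unfolding smooth_manifold_def by blast
  ultimately show ?thesis by (simp add: openin_open_eq)
qed

lemma openin_Int_chart: "c \<in> A \<Longrightarrow> openin T W \<Longrightarrow> openin T (W \<inter> chart_dom c)"
  by (rule openin_Int[OF _ openin_chart])

lemma open_coord_image_Int: "c \<in> A \<Longrightarrow> openin T W \<Longrightarrow> open (coord c ` (W \<inter> chart_dom c))"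
  by (rule open_coord_image[OF _ openin_Int_chart]) simp_all

text \<open>Derivatives are taken after composition with \<open>chart_inv c\<close>; this translates
  a neighbourhood of \<open>p\<close> in the manifold into one of \<open>coord c p\<close>.\<close>

lemma eventually_chart:
  assumes "c \<in> A" "openin T W" "p \<in> W" "p \<in> chart_dom c"
  shows "\<forall>\<^sub>F u in nhds (coord c p). chart_inv c u \<in> W \<and> chart_inv c u \<in> chart_dom c \<and> coord c (chart_inv c u) = u"
proof -
  let ?V = "W \<inter> chart_dom c"
  have "open (coord c ` ?V)"
    using assms by (simp add: open_coord_image_Int)
  then have "\<forall>\<^sub>F u in nhds (coord c p). u \<in> coord c ` ?V"
    by (rule eventually_nhds_in_open) (use assms in auto)
  then show ?thesis
    by eventually_elim (use chart_inv_image[OF assms(1), of _ ?V] in auto)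
qed

lemma chart_cong:
  assumes "c \<in> A" "openin T W" "p \<in> W" "p \<in> chart_dom c"
    and eq: "\<And>p. p \<in> W \<Longrightarrow> p \<in> chart_dom c \<Longrightarrow> F p = G p"
  shows "chart_diff c F p \<longleftrightarrow> chart_diff c G p" "chart_deriv c F p = chart_deriv c G p"
proof -
  have "\<forall>\<^sub>F u in nhds (coord c p). (F \<circ> chart_inv c) u = (G \<circ> chart_inv c) u"
    using eventually_chart[OF assms(1-4)] by eventually_elim (simp add: eq)
  then have "((F \<circ> chart_inv c) has_derivative D) (at (coord c p)) \<longleftrightarrow>
      ((G \<circ> chart_inv c) has_derivative D) (at (coord c p))" for D
    by (rule has_derivative_transform_nhds)
  then show "chart_diff c F p \<longleftrightarrow> chart_diff c G p" "chart_deriv c F p = chart_deriv c G p"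
    by (auto simp: chart_diff_def differentiable_def chart_deriv_def frechet_derivative_def)
qed

lemma smooth_fun_diff:
  assumes "smooth_fun A U F" "c \<in> A" "p \<in> U" "p \<in> chart_dom c"
  shows "chart_diff c F p"
proof -
  have "Ck_on (Suc 0) (coord c ` (U \<inter> chart_dom c)) (F \<circ> chart_inv c)"
    using assms unfolding smooth_fun_def smooth_on_def by blast
  then show ?thesis using assms(3,4) unfolding Ck_on.simps chart_diff_def by blast
qed

lemma smooth_on_transition:
  "c \<in> A \<Longrightarrow> d \<in> A \<Longrightarrow> smooth_on (coord c ` (chart_dom c \<inter> chart_dom d)) (coord d \<circ> chart_inv c)"
  using mfd unfolding smooth_manifold_def by blast

lemma smooth_fun_coord: "d \<in> A \<Longrightarrow> smooth_fun A (chart_dom d) (coord d)"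
  using smooth_on_transition unfolding smooth_fun_def by (simp add: Int_commute)

lemma coord_diff: "c \<in> A \<Longrightarrow> d \<in> A \<Longrightarrow> p \<in> chart_dom c \<Longrightarrow> p \<in> chart_dom d \<Longrightarrow> chart_diff c (coord d) p"
  by (rule smooth_fun_diff[OF smooth_fun_coord])

text \<open>\<open>smooth_fun\<close> tests all charts, but one chart containing \<open>W\<close> is
  enough: any other differs from it by a smooth transition map.\<close>

lemma smooth_funI:
  assumes "c \<in> A" "openin T W" "W \<subseteq> chart_dom c" "smooth_on (coord c ` W) (F \<circ> chart_inv c)"
  shows "smooth_fun A W F"
  unfolding smooth_fun_def smooth_on_def
proof (intro ballI allI)
  fix d k assume d: "d \<in> A"
  let ?D = "coord d ` (W \<inter> chart_dom d)"
  let ?t = "coord c \<circ> chart_inv d"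
  have inv: "chart_inv d u \<in> W \<inter> chart_dom d" if "u \<in> ?D" for u
    using chart_inv_image(1)[OF d that] by simp
  have op: "open ?D" using d assms by (simp add: open_coord_image_Int)
  have "Ck_on k ?D (\<lambda>u. (F \<circ> chart_inv c) (?t u))"
  proof (rule Ck_on_compose[OF op open_coord_image[OF assms(1-3)]])
    show "Ck_on k (coord c ` W) (F \<circ> chart_inv c)"
      using assms(4) by (simp add: smooth_on_def)
    show "Ck_on k ?D ?t"
      using smooth_on_transition[OF d assms(1)] assms(3) unfolding smooth_on_def
      by (blast intro: Ck_on_subset)
    show "?t ` ?D \<subseteq> coord c ` W" using inv by auto
  qed
  then show "Ck_on k ?D (F \<circ> chart_inv d)"
  proof (rule Ck_on_cong[OF op, THEN iffD1, rotated])
    show "(F \<circ> chart_inv c) (?t u) = (F \<circ> chart_inv d) u" if "u \<in> ?D" for u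
      using inv[OF that] chart_inv_coord[OF assms(1)] assms(3) by (simp add: subset_iff)
  qed
qed

lemma smooth_fun_cong:
  assumes "openin T W" "\<And>p. p \<in> W \<Longrightarrow> F p = G p" "smooth_fun A W F"
  shows "smooth_fun A W G"
  unfolding smooth_fun_def smooth_on_def
proof (intro ballI allI)
  fix c k assume c: "c \<in> A"
  have op: "open (coord c ` (W \<inter> chart_dom c))"
    using c assms by (simp add: open_coord_image_Int)
  have "Ck_on k (coord c ` (W \<inter> chart_dom c)) (F \<circ> chart_inv c)"
    using assms(3) c by (simp add: smooth_fun_def smooth_on_def)
  then show "Ck_on k (coord c ` (W \<inter> chart_dom c)) (G \<circ> chart_inv c)"
    by (rule Ck_on_cong[OF op, THEN iffD1, rotated])
      (use chart_inv_image(1)[OF c, of _ "W \<inter> chart_dom c"] assms(2) in auto)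
qed

lemma smooth_fun_minus:
  assumes "openin T W" "smooth_fun A W F" "smooth_fun A W G"
  shows "smooth_fun A W (\<lambda>p. F p - G p)"
  unfolding smooth_fun_def smooth_on_def
proof (intro ballI allI)
  fix c k assume c: "c \<in> A"
  have op: "open (coord c ` (W \<inter> chart_dom c))"
    using c assms by (simp add: open_coord_image_Int)
  have "Ck_on k (coord c ` (W \<inter> chart_dom c))
      (\<lambda>u. (F \<circ> chart_inv c) u + - (G \<circ> chart_inv c) u)"
    by (intro Ck_on_add op Ck_on_bounded_linear[OF bounded_linear_minus[OF bounded_linear_ident]])
      (use assms c in \<open>unfold smooth_fun_def smooth_on_def, blast+\<close>)
  then show "Ck_on k (coord c ` (W \<inter> chart_dom c)) ((\<lambda>p. F p - G p) \<circ> chart_inv c)"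
    by (simp add: comp_def)
qed

lemma smooth_fun_subset: "smooth_fun A U F \<Longrightarrow> V \<subseteq> U \<Longrightarrow> smooth_fun A V F"
  unfolding smooth_fun_def smooth_on_def by (blast intro: Ck_on_subset)

lemma chart_deriv_linear_apply:
  fixes u :: "'a \<Rightarrow> 'd::euclidean_space" and L :: "'a \<Rightarrow> 'd \<Rightarrow> 'w::real_normed_vector"
  assumes c: "c \<in> A" "openin T W" "p \<in> W" "p \<in> chart_dom c"
    and L: "\<And>p. p \<in> W \<Longrightarrow> p \<in> chart_dom c \<Longrightarrow> linear (L p)" "\<And>y. chart_diff c (\<lambda>p. L p y) p"
    and u: "chart_diff c u p"
  shows "chart_diff c (\<lambda>p. L p (u p)) p"
    "chart_deriv c (\<lambda>p. L p (u p)) p v =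
      chart_deriv c (\<lambda>p'. L p' (u p)) p v + L p (chart_deriv c u p v)"
proof -
  let ?S = "coord c ` (W \<inter> chart_dom c)"
  have "((\<lambda>x. L (chart_inv c x) ((u \<circ> chart_inv c) x)) has_derivative
      (\<lambda>v. chart_deriv c (\<lambda>p'. L p' ((u \<circ> chart_inv c) (coord c p))) p v +
        L (chart_inv c (coord c p)) (chart_deriv c u p v))) (at (coord c p))"
  proof (rule has_derivative_linear_apply[where S = ?S])
    show "open ?S" using c by (simp add: open_coord_image_Int)
    show "linear (L (chart_inv c x))" if "x \<in> ?S" for x
      using chart_inv_image(1)[OF c(1) that] by (intro L) auto
  qed (use c L(2)[unfolded chart_diff_works] u[unfolded chart_diff_works] in \<open>auto simp: comp_def\<close>)
  then have "((\<lambda>p. L p (u p)) \<circ> chart_inv c has_derivative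
      (\<lambda>v. chart_deriv c (\<lambda>p'. L p' (u p)) p v + L p (chart_deriv c u p v))) (at (coord c p))"
    using c by (simp add: chart_inv_coord comp_def)
  from chart_derivI[OF this] show "chart_diff c (\<lambda>p. L p (u p)) p"
    "chart_deriv c (\<lambda>p. L p (u p)) p v =
      chart_deriv c (\<lambda>p'. L p' (u p)) p v + L p (chart_deriv c u p v)" by auto
qed

lemma chart_deriv_bilinear_apply:
  fixes u :: "'a \<Rightarrow> 'd::euclidean_space" and w :: "'a \<Rightarrow> 'd'::euclidean_space"
    and P :: "'a \<Rightarrow> 'd \<Rightarrow> 'd' \<Rightarrow> 'w::real_normed_vector"
  assumes c: "c \<in> A" "openin T W" "p \<in> W" "p \<in> chart_dom c"
    and P: "\<And>p. p \<in> W \<Longrightarrow> p \<in> chart_dom c \<Longrightarrow> bilinear (P p)" "\<And>y z. chart_diff c (\<lambda>p. P p y z) p"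
    and u: "chart_diff c u p" and w: "chart_diff c w p"
  shows "chart_diff c (\<lambda>p. P p (u p) (w p)) p"
    "chart_deriv c (\<lambda>p. P p (u p) (w p)) p v =
      chart_deriv c (\<lambda>p'. P p' (u p) (w p)) p v +
      P p (chart_deriv c u p v) (w p) + P p (u p) (chart_deriv c w p v)"
proof -
  note right = chart_deriv_linear_apply[OF c bilinear_right[OF P(1)] P(2) w]
  note left = chart_deriv_linear_apply[where L = "\<lambda>p y. P p y (w p)", OF c bilinear_left[OF P(1)] right(1) u]
  show "chart_diff c (\<lambda>p. P p (u p) (w p)) p" by (rule left(1))
  show "chart_deriv c (\<lambda>p. P p (u p) (w p)) p v =
      chart_deriv c (\<lambda>p'. P p' (u p) (w p)) p v +
      P p (chart_deriv c u p v) (w p) + P p (u p) (chart_deriv c w p v)"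
    using left(2)[of v] right(2)[of "u p" v] by simp
qed

end

text \<open>The charts \<open>b\<close> and \<open>a\<close> may belong to different manifolds. With
  \<open>\<iota>\<close> the identity this is a change of chart; with the immersion it pulls ambient
  functions back.\<close>

lemma chart_deriv_compose:
  assumes b: "chart_inv b (coord b q) = q"
    and a: "\<forall>\<^sub>F u in nhds (coord b q). chart_inv a (coord a (\<iota> (chart_inv b u))) = \<iota> (chart_inv b u)"
    and \<iota>: "chart_diff b (coord a \<circ> \<iota>) q" and F: "chart_diff a F (\<iota> q)"
  shows "chart_diff b (\<lambda>q. F (\<iota> q)) q"
    "chart_deriv b (\<lambda>q. F (\<iota> q)) q v = chart_deriv a F (\<iota> q) (chart_deriv b (coord a \<circ> \<iota>) q v)"
proof -
  have "((F \<circ> chart_inv a) has_derivative chart_deriv a F (\<iota> q))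
      (at ((coord a \<circ> \<iota> \<circ> chart_inv b) (coord b q)))"
    using F by (simp add: chart_diff_works b)
  from has_derivative_compose[OF \<iota>[unfolded chart_diff_works] this]
  have "((\<lambda>q. F (\<iota> q)) \<circ> chart_inv b has_derivative
      (\<lambda>v. chart_deriv a F (\<iota> q) (chart_deriv b (coord a \<circ> \<iota>) q v))) (at (coord b q))"
  proof (rule has_derivative_transform_nhds[THEN iffD1, rotated])
    show "\<forall>\<^sub>F u in nhds (coord b q). (F \<circ> chart_inv a) ((coord a \<circ> \<iota> \<circ> chart_inv b) u) =
        ((\<lambda>q. F (\<iota> q)) \<circ> chart_inv b) u"
      using a by eventually_elim simp
  qed
  from chart_derivI[OF this] show "chart_diff b (\<lambda>q. F (\<iota> q)) q"
    "chart_deriv b (\<lambda>q. F (\<iota> q)) q v = chart_deriv a F (\<iota> q) (chart_deriv b (coord a \<circ> \<iota>) q v)"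
    by auto
qed

section \<open>Change of chart, vector fields and directional derivatives\<close>

context smooth_mfd
begin

lemma chart_change:
  assumes "c \<in> A" "d \<in> A" "p \<in> chart_dom c" "p \<in> chart_dom d" "chart_diff d F p"
  shows "chart_diff c F p" "chart_deriv c F p v = chart_deriv d F p (chart_deriv c (coord d) p v)"
proof -
  have ev: "\<forall>\<^sub>F u in nhds (coord c p). chart_inv d (coord d (chart_inv c u)) = chart_inv c u"
    using eventually_chart[OF assms(1) openin_chart[OF assms(2)] assms(4,3)]
    by eventually_elim (simp add: chart_inv_coord assms(2))
  show "chart_diff c F p" "chart_deriv c F p v = chart_deriv d F p (chart_deriv c (coord d) p v)"
    using chart_deriv_compose[of c p d "\<lambda>x. x" F, OF chart_inv_coord[OF assms(1,3)] ev] coord_diff assms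
    by (auto simp: comp_def)
qed

lemma chart_deriv_coord_self:
  assumes "c \<in> A" "p \<in> chart_dom c"
  shows "chart_deriv c (coord c) p v = v"
proof -
  have "\<forall>\<^sub>F u in nhds (coord c p). (coord c \<circ> chart_inv c) u = u"
    using eventually_chart[OF assms(1) openin_chart[OF assms(1)] assms(2,2)] by eventually_elim simp
  then have "((coord c \<circ> chart_inv c) has_derivative (\<lambda>v. v)) (at (coord c p))"
    by (rule has_derivative_transform_nhds[THEN iffD2]) (rule has_derivative_ident)
  then show ?thesis by (simp add: chart_derivI(2))
qed

lemma vector_field_openin: "smooth_vector_field T A U X \<Longrightarrow> openin T U"
  unfolding smooth_vector_field_def by blast

lemma vector_field_diff:
  assumes "smooth_vector_field T A U X" "c \<in> A" "d \<in> A" "p \<in> U" "p \<in> chart_dom c" "p \<in> chart_dom d"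
  shows "chart_diff c (X d) p"
  using assms smooth_fun_diff[of "U \<inter> chart_dom d" "X d" c p] unfolding smooth_vector_field_def by blast

lemma vector_field_transform:
  assumes "smooth_vector_field T A U X" "c \<in> A" "d \<in> A" "p \<in> U" "p \<in> chart_dom c" "p \<in> chart_dom d"
  shows "X d p = chart_deriv c (coord d) p (X c p)"
  using assms unfolding smooth_vector_field_def by blast

lemma vector_field_subset:
  assumes "smooth_vector_field T A U X" "openin T V" "V \<subseteq> U"
  shows "smooth_vector_field T A V X"
  unfolding smooth_vector_field_def
proof (intro conjI ballI)
  show "smooth_fun A (V \<inter> chart_dom c) (X c)" if "c \<in> A" for c
    using assms(1,3) that unfolding smooth_vector_field_def
    by (blast intro: smooth_fun_subset[of "U \<inter> chart_dom c"])
  show "X d p = chart_deriv c (coord d) p (X c p)"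
    if "c \<in> A" "d \<in> A" "p \<in> V \<inter> chart_dom c \<inter> chart_dom d" for c d p
    using vector_field_transform[OF assms(1), of c d p] that assms(3) by blast
qed (fact assms(2))

lemma vector_field_cong:
  assumes "smooth_vector_field T A U X" "\<And>c p. c \<in> A \<Longrightarrow> p \<in> U \<Longrightarrow> p \<in> chart_dom c \<Longrightarrow> X c p = Y c p"
  shows "smooth_vector_field T A U Y"
  unfolding smooth_vector_field_def
proof (intro conjI ballI)
  show U: "openin T U" by (rule vector_field_openin[OF assms(1)])
  show "smooth_fun A (U \<inter> chart_dom c) (Y c)" if "c \<in> A" for c
    by (rule smooth_fun_cong[of "U \<inter> chart_dom c" "X c"])
      (use assms that openin_Int_chart[OF that U] in \<open>unfold smooth_vector_field_def, blast+\<close>)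
  show "Y d p = chart_deriv c (coord d) p (Y c p)"
    if "c \<in> A" "d \<in> A" "p \<in> U \<inter> chart_dom c \<inter> chart_dom d" for c d p
    using vector_field_transform[OF assms(1), of c d p] assms(2)[of c p] assms(2)[of d p] that by simp
qed

lemma vector_field_minus:
  assumes X: "smooth_vector_field T A U X" and Y: "smooth_vector_field T A U Y"
  shows "smooth_vector_field T A U (\<lambda>c p. X c p - Y c p)"
  unfolding smooth_vector_field_def
proof (intro conjI ballI)
  show "openin T U" by (rule vector_field_openin[OF X])
  show "smooth_fun A (U \<inter> chart_dom c) (\<lambda>p. X c p - Y c p)" if "c \<in> A" for c
    by (intro smooth_fun_minus openin_Int_chart)
      (use X Y that in \<open>unfold smooth_vector_field_def, blast+\<close>)
  show "X d p - Y d p = chart_deriv c (coord d) p (X c p - Y c p)"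
    if "c \<in> A" "d \<in> A" "p \<in> U \<inter> chart_dom c \<inter> chart_dom d" for c d p
    using that vector_field_transform[OF X, of c d p] vector_field_transform[OF Y, of c d p]
      linear_diff[OF linear_chart_deriv[OF coord_diff[of c d p]]] by simp
qed

text \<open>The Jacobian produced by the chain rule is absorbed by the transformation law of
  \<open>X\<close>, so the arbitrary chart in \<open>dir_deriv\<close> can be traded for any
  other.\<close>

lemma dir_deriv_eq:
  assumes "smooth_vector_field T A U X" "p \<in> U" "c \<in> A" "p \<in> chart_dom c" "chart_diff c F p"
  shows "dir_deriv A X F p = chart_deriv c F p (X c p)"
proof -
  let ?d = "chart_at A p"
  have d: "?d \<in> A" "p \<in> chart_dom ?d" using chart_at[OF in_topspace[OF assms(3,4)]] by auto
  show ?thesis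
    unfolding dir_deriv_def chart_change(2)[OF d(1) assms(3) d(2) assms(4,5)]
    using vector_field_transform[OF assms(1) d(1) assms(3,2) d(2) assms(4)] by simp
qed

lemma dir_deriv_cong:
  assumes "openin T W" "p \<in> W" "\<And>p. p \<in> W \<Longrightarrow> F p = G p"
  shows "dir_deriv A X F p = dir_deriv A X G p"
proof -
  have "p \<in> topspace T" using assms openin_subset by blast
  then show ?thesis
    unfolding dir_deriv_def using chart_cong(2)[OF chart_at(1) assms(1,2) chart_at(2)] assms(3) by metis
qed

lemma dir_deriv_const [simp]: "dir_deriv A X (\<lambda>p. k) p = 0"
  by (simp add: dir_deriv_def)

end

text \<open>The constant-coefficient combination of the coordinate fields of \<open>c\<close>,
  written in all charts. It extends a tangent vector to a smooth field on the chart domain, so that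
  identities for fields can be tested on vectors.\<close>

definition coord_field :: "('a, 'e::euclidean_space) chart \<Rightarrow> 'e \<Rightarrow> ('a, 'e) field" where
  "coord_field c x = (\<lambda>d p. chart_deriv c (coord d) p x)"

context smooth_mfd
begin

lemma coord_field_self: "c \<in> A \<Longrightarrow> p \<in> chart_dom c \<Longrightarrow> coord_field c x c p = x"
  by (simp add: coord_field_def chart_deriv_coord_self)

text \<open>The components in another chart are first derivatives of a transition map; the
  transformation law is the chain rule for two successive changes of chart.\<close>

lemma smooth_coord_field:
  assumes c: "c \<in> A"
  shows "smooth_vector_field T A (chart_dom c) (coord_field c x)"
  unfolding smooth_vector_field_def
proof (intro conjI ballI)
  show "openin T (chart_dom c)" by (rule openin_chart[OF c])
  show "smooth_fun A (chart_dom c \<inter> chart_dom d) (coord_field c x d)" if d: "d \<in> A" for d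
  proof (rule smooth_funI[OF c])
    let ?W = "chart_dom c \<inter> chart_dom d"
    show op: "openin T ?W" by (rule openin_Int_chart[OF d openin_chart[OF c]])
    show "smooth_on (coord c ` ?W) (coord_field c x d \<circ> chart_inv c)"
      unfolding smooth_on_def
    proof
      fix k
      have "Ck_on (Suc k) (coord c ` ?W) (coord d \<circ> chart_inv c)"
        using smooth_on_transition[OF c d] by (simp add: smooth_on_def del: Ck_on.simps)
      then have "Ck_on k (coord c ` ?W) (\<lambda>u. frechet_derivative (coord d \<circ> chart_inv c) (at u) x)"
        by simp
      then show "Ck_on k (coord c ` ?W) (coord_field c x d \<circ> chart_inv c)"
      proof (rule Ck_on_cong[OF open_coord_image[OF c op], THEN iffD1, rotated 2])
        show "frechet_derivative (coord d \<circ> chart_inv c) (at u) x = (coord_field c x d \<circ> chart_inv c) u"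
          if "u \<in> coord c ` ?W" for u
          using chart_inv_image(2)[OF c that] by (simp add: coord_field_def chart_deriv_def)
      qed auto
    qed
  qed auto
  show "coord_field c x e p = chart_deriv d (coord e) p (coord_field c x d p)"
    if "d \<in> A" "e \<in> A" "p \<in> chart_dom c \<inter> chart_dom d \<inter> chart_dom e" for d e p
    unfolding coord_field_def
    by (rule chart_change(2)[OF c that(1) _ _ coord_diff]) (use that c in auto)
qed

end

section \<open>The Levi-Civita connection in components\<close>

locale lc_mfd = smooth_mfd +
  fixes g \<Gamma>
  assumes lc: "levi_civita T A g \<Gamma>"
begin

lemma bilinear_christoffel: "c \<in> A \<Longrightarrow> p \<in> chart_dom c \<Longrightarrow> bilinear (\<Gamma> c p)"
  using lc unfolding levi_civita_def affine_connection_def by blast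

lemma smooth_nabla:
  "smooth_vector_field T A U X \<Longrightarrow> smooth_vector_field T A U Y \<Longrightarrow> smooth_vector_field T A U (nabla A \<Gamma> X Y)"
  by (rule lc[unfolded levi_civita_def affine_connection_def, THEN conjunct1, THEN conjunct2, rule_format,
        OF conjI])

lemma torsion_free:
  "smooth_vector_field T A U X \<Longrightarrow> smooth_vector_field T A U Y \<Longrightarrow> c \<in> A \<Longrightarrow> p \<in> U \<Longrightarrow> p \<in> chart_dom c \<Longrightarrow>
    nabla A \<Gamma> X Y c p - nabla A \<Gamma> Y X c p = lie_bracket A X Y c p"
  by (rule lc[unfolded levi_civita_def, THEN conjunct2, THEN conjunct1, rule_format, OF conjI]) auto

text \<open>Torsion-freeness writes the bracket as a difference of covariant derivatives, which
  already obey the transformation law; no second derivatives of transition maps have to be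
  cancelled.\<close>

lemma smooth_lie_bracket:
  assumes "smooth_vector_field T A U X" "smooth_vector_field T A U Y"
  shows "smooth_vector_field T A U (lie_bracket A X Y)"
  by (rule vector_field_cong[OF vector_field_minus[OF smooth_nabla[OF assms] smooth_nabla[OF assms(2,1)]]])
    (rule torsion_free[OF assms])

lemma smooth_curvature:
  assumes "smooth_vector_field T A U X" "smooth_vector_field T A U Y" "smooth_vector_field T A U Z"
  shows "smooth_vector_field T A U (curvature A \<Gamma> X Y Z)"
  unfolding curvature_def
  by (intro vector_field_minus smooth_nabla smooth_lie_bracket assms)

lemma nabla_eq:
  assumes X: "smooth_vector_field T A U X" and Y: "smooth_vector_field T A U Y"
    and "c \<in> A" "p \<in> U" "p \<in> chart_dom c"
  shows "nabla A \<Gamma> X Y c p = chart_deriv c (Y c) p (X c p) + \<Gamma> c p (X c p) (Y c p)"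
  by (simp add: nabla_def
      dir_deriv_eq[OF X assms(4,3,5) vector_field_diff[OF Y assms(3,3,4,5,5)]])

text \<open>The components are constant in their own chart, so the derivative term drops out and the
  connection reveals its Christoffel symbols.\<close>

lemma nabla_coord_field:
  assumes c: "c \<in> A" "p \<in> chart_dom c"
  shows "nabla A \<Gamma> (coord_field c x) (coord_field c y) c p = \<Gamma> c p x y"
proof -
  have "chart_deriv c (coord_field c y c) p = chart_deriv c (\<lambda>p. y) p"
    by (rule chart_cong(2)[OF c(1) openin_chart[OF c(1)] c(2,2)]) (rule coord_field_self[OF c(1)])
  then show ?thesis
    using c nabla_eq[OF smooth_coord_field[OF c(1)] smooth_coord_field[OF c(1)] c(1) c(2,2)]
    by (simp add: coord_field_self)
qed

text \<open>Coordinate fields commute, so on them torsion-freeness is symmetry of the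
  symbols.\<close>

lemma christoffel_sym:
  assumes c: "c \<in> A" "p \<in> chart_dom c"
  shows "\<Gamma> c p x y = \<Gamma> c p y x"
proof -
  have const: "dir_deriv A X (coord_field c z c) p = 0" for X z
    using dir_deriv_cong[OF openin_chart[OF c(1)] c(2), of "coord_field c z c" "\<lambda>p. z"]
      coord_field_self[OF c(1)] by simp
  have "nabla A \<Gamma> (coord_field c x) (coord_field c y) c p - nabla A \<Gamma> (coord_field c y) (coord_field c x) c p
      = lie_bracket A (coord_field c x) (coord_field c y) c p"
    by (rule torsion_free[OF smooth_coord_field[OF c(1)] smooth_coord_field[OF c(1)] c(1) c(2,2)])
  then show ?thesis using c by (simp add: nabla_coord_field lie_bracket_def const)
qed

text \<open>The left side is kept as a \<open>dir_deriv\<close>, because the locale contains no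
  differentiability of \<open>g\<close> that would permit another chart.\<close>

lemma metric_christoffel:
  assumes c: "c \<in> A" "p \<in> chart_dom c"
  shows "dir_deriv A (coord_field c x) (\<lambda>p. g c p y z) p = g c p (\<Gamma> c p x y) z + g c p y (\<Gamma> c p x z)"
proof -
  let ?X = "coord_field c"
  note X = smooth_coord_field[OF c(1)]
  have "dir_deriv A (?X x) (\<lambda>p. g c p (?X y c p) (?X z c p)) p =
      g c p (nabla A \<Gamma> (?X x) (?X y) c p) (?X z c p) + g c p (?X y c p) (nabla A \<Gamma> (?X x) (?X z) c p)"
    by (rule lc[unfolded levi_civita_def, THEN conjunct2, THEN conjunct2, rule_format,
          OF conjI[OF X conjI[OF X X]] c(1)]) (simp add: c)
  moreover have "dir_deriv A (?X x) (\<lambda>p. g c p (?X y c p) (?X z c p)) p = dir_deriv A (?X x) (\<lambda>p. g c p y z) p"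
    by (rule dir_deriv_cong[OF openin_chart[OF c(1)] c(2)]) (simp add: coord_field_self[OF c(1)])
  ultimately show ?thesis using c by (simp add: nabla_coord_field coord_field_self)
qed

end

section \<open>Invariant submanifolds\<close>

lemma chart_deriv_scaleR:
  assumes "chart_diff c F p" "chart_diff c G p" "chart_inv c (coord c p) = p"
  shows "chart_deriv c (\<lambda>p. F p *\<^sub>R G p) p v = F p *\<^sub>R chart_deriv c G p v + chart_deriv c F p v *\<^sub>R G p"
proof -
  have "((\<lambda>p. F p *\<^sub>R G p) \<circ> chart_inv c has_derivative
      (\<lambda>v. F p *\<^sub>R chart_deriv c G p v + chart_deriv c F p v *\<^sub>R G p)) (at (coord c p))"
    using has_derivative_scaleR[OF assms(1,2)[unfolded chart_diff_works]] assms(3) by (simp add: comp_def)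
  from chart_derivI(2)[OF this] show ?thesis by simp
qed

section \<open>The structure equations in components\<close>

locale invariant_gssf =
  fixes n :: nat
    and T :: "'a topology" and A :: "('a, 'e::euclidean_space) chart set"
    and \<phi> :: "('a, 'e) chart \<Rightarrow> 'a \<Rightarrow> 'e \<Rightarrow> 'e" and \<xi> :: "('a, 'e) field"
    and \<eta> :: "('a, 'e) chart \<Rightarrow> 'a \<Rightarrow> 'e \<Rightarrow> real"
    and g :: "('a, 'e) chart \<Rightarrow> 'a \<Rightarrow> 'e \<Rightarrow> 'e \<Rightarrow> real"
    and \<Gamma> :: "('a, 'e) christoffel"
    and f1 f2 f3 :: "'a \<Rightarrow> real"
    and S :: "'b topology" and B :: "('b, 'f::euclidean_space) chart set"
    and \<iota> :: "'b \<Rightarrow> 'a"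
    and gM :: "('b, 'f) chart \<Rightarrow> 'b \<Rightarrow> 'f \<Rightarrow> 'f \<Rightarrow> real"
    and \<Gamma>M :: "('b, 'f) christoffel"
  assumes gssf: "gen_sasakian_space_form n T A \<phi> \<xi> \<eta> g \<Gamma> f1 f2 f3"
    and invariant: "invariant_submanifold S B T A \<iota> \<phi> \<xi>"
    and induced: "induced_metric B A \<iota> g gM"
    and lcM: "levi_civita S B gM \<Gamma>M"
begin

lemma immersion: "immersion S B T A \<iota>"
  using invariant unfolding invariant_submanifold_def by blast

lemma acm: "almost_contact_metric_manifold T A \<phi> \<xi> \<eta> g"
  using gssf unfolding gen_sasakian_space_form_def by (elim conjE)

sublocale amb: lc_mfd T A g \<Gamma>
proof
  show "smooth_manifold T A"
    using acm unfolding almost_contact_metric_manifold_def by (elim conjE)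
  show "levi_civita T A g \<Gamma>"
    using gssf unfolding gen_sasakian_space_form_def by (elim conjE)
qed

sublocale sub: lc_mfd S B gM \<Gamma>M
proof
  show "smooth_manifold S B"
    using immersion unfolding immersion_def by (elim conjE)
qed (fact lcM)

definition f :: "'a \<Rightarrow> real" where "f p = f1 p - f3 p"

lemma acm_pointwise:
  assumes "a \<in> A" "p \<in> chart_dom a"
  shows "\<phi> a p (\<phi> a p x) = - x + \<eta> a p x *\<^sub>R \<xi> a p" "\<phi> a p (\<xi> a p) = 0" "\<eta> a p (\<xi> a p) = 1"
    "g a p x (\<xi> a p) = \<eta> a p x" "\<eta> a p (\<phi> a p x) = 0"
proof -
  have *: "\<forall>c\<in>A. \<forall>p\<in>chart_dom c.
        (\<forall>x. \<phi> c p (\<phi> c p x) = - x + \<eta> c p x *\<^sub>R \<xi> c p) \<and>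
        \<phi> c p (\<xi> c p) = 0 \<and>
        \<eta> c p (\<xi> c p) = 1 \<and>
        (\<forall>x. g c p x (\<xi> c p) = \<eta> c p x) \<and>
        (\<forall>x. \<eta> c p (\<phi> c p x) = 0) \<and>
        (\<forall>x y. g c p (\<phi> c p x) (\<phi> c p y) = g c p x y - \<eta> c p x * \<eta> c p y)"
    using acm unfolding almost_contact_metric_manifold_def by (elim conjE)
  from *[THEN bspec, OF assms(1), THEN bspec, OF assms(2)]
  show "\<phi> a p (\<phi> a p x) = - x + \<eta> a p x *\<^sub>R \<xi> a p" "\<phi> a p (\<xi> a p) = 0" "\<eta> a p (\<xi> a p) = 1"
    "g a p x (\<xi> a p) = \<eta> a p x" "\<eta> a p (\<phi> a p x) = 0" by auto
qed

lemma smooth_xi: "smooth_vector_field T A (topspace T) \<xi>"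
  using acm unfolding almost_contact_metric_manifold_def by (elim conjE)

lemma smooth_xi_chart: "a \<in> A \<Longrightarrow> smooth_vector_field T A (chart_dom a) \<xi>"
  by (rule amb.vector_field_subset[OF smooth_xi amb.openin_chart openin_subset[OF amb.openin_chart]])

lemma xi_diff: "a \<in> A \<Longrightarrow> p \<in> chart_dom a \<Longrightarrow> chart_diff a (\<xi> a) p"
  by (rule amb.vector_field_diff[OF smooth_xi_chart])

lemma endo: "smooth_endo_field A \<phi>"
  using acm unfolding almost_contact_metric_manifold_def by (elim conjE)

lemma linear_phi: "a \<in> A \<Longrightarrow> p \<in> chart_dom a \<Longrightarrow> linear (\<phi> a p)"
  using endo unfolding smooth_endo_field_def by blast

lemma phi_diff: "a \<in> A \<Longrightarrow> p \<in> chart_dom a \<Longrightarrow> chart_diff a (\<lambda>p. \<phi> a p x) p"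
  by (rule amb.smooth_fun_diff) (use endo in \<open>unfold smooth_endo_field_def, blast+\<close>)

lemma metric: "riemannian_metric A g"
  using acm unfolding almost_contact_metric_manifold_def by (elim conjE)

lemma bilinear_g: "a \<in> A \<Longrightarrow> p \<in> chart_dom a \<Longrightarrow> bilinear (g a p)"
  and g_sym: "a \<in> A \<Longrightarrow> p \<in> chart_dom a \<Longrightarrow> g a p x y = g a p y x"
  and g_pos: "a \<in> A \<Longrightarrow> p \<in> chart_dom a \<Longrightarrow> x \<noteq> 0 \<Longrightarrow> g a p x x > 0"
  using metric unfolding riemannian_metric_def by blast+

lemma g_diff: "a \<in> A \<Longrightarrow> p \<in> chart_dom a \<Longrightarrow> chart_diff a (\<lambda>p. g a p x y) p"
  by (rule amb.smooth_fun_diff) (use metric in \<open>unfold riemannian_metric_def, blast+\<close>)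

lemma f_diff:
  assumes "a \<in> A" "p \<in> chart_dom a"
  shows "chart_diff a f p"
proof -
  have "smooth_fun A (topspace T) f1" "smooth_fun A (topspace T) f3"
    using gssf unfolding gen_sasakian_space_form_def by blast+
  then have "chart_diff a f1 p" "chart_diff a f3 p"
    using amb.smooth_fun_diff[OF _ assms(1) amb.in_topspace[OF assms] assms(2)] by auto
  from chart_diff_minus(1)[OF this] show ?thesis unfolding f_def .
qed

text \<open>Testing on coordinate fields turns the identities for fields into identities between
  components at a point, here and in the next two lemmas. In this form they can be pulled back to
  \<open>M\<close>, where vectors along the immersion need not come from ambient fields.\<close>

lemma nabla_g:
  assumes a: "a \<in> A" "p \<in> chart_dom a"
  shows "chart_deriv a (\<lambda>p. g a p y z) p x = g a p (\<Gamma> a p x y) z + g a p y (\<Gamma> a p x z)"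
  using amb.metric_christoffel[OF a, of x y z] amb.coord_field_self[OF a]
    amb.dir_deriv_eq[OF amb.smooth_coord_field[OF a(1)] a(2,1,2) g_diff[OF a]] by simp

lemma nabla_xi:
  assumes a: "a \<in> A" "p \<in> chart_dom a"
  shows "chart_deriv a (\<xi> a) p x + \<Gamma> a p x (\<xi> a p) = - (f p *\<^sub>R \<phi> a p x)"
proof -
  have *: "\<forall>U X. smooth_vector_field T A U X \<longrightarrow>
        (\<forall>c\<in>A. \<forall>p \<in> U \<inter> chart_dom c.
           nabla A \<Gamma> X \<xi> c p = - ((f1 p - f3 p) *\<^sub>R \<phi> c p (X c p)))"
    using gssf unfolding gen_sasakian_space_form_def by (elim conjE)
  have "nabla A \<Gamma> (coord_field a x) \<xi> a p = - ((f1 p - f3 p) *\<^sub>R \<phi> a p (coord_field a x a p))"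
    by (rule *[rule_format, OF amb.smooth_coord_field[OF a(1)] a(1)]) (simp add: a)
  then show ?thesis
    using amb.nabla_eq[OF amb.smooth_coord_field[OF a(1)] smooth_xi_chart[OF a(1)] a(1) a(2,2)]
    by (simp add: amb.coord_field_self[OF a] f_def)
qed

lemma nabla_phi:
  assumes a: "a \<in> A" "p \<in> chart_dom a"
  shows "chart_deriv a (\<lambda>p. \<phi> a p y) p x + \<Gamma> a p x (\<phi> a p y) =
    \<phi> a p (\<Gamma> a p x y) + f p *\<^sub>R (g a p x y *\<^sub>R \<xi> a p - \<eta> a p y *\<^sub>R x)"
proof -
  let ?X = "coord_field a x" and ?Y = "coord_field a y"
  note cf = amb.smooth_coord_field[OF a(1)]
  have *: "\<forall>U X Y. smooth_vector_field T A U X \<and> smooth_vector_field T A U Y \<longrightarrow>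
        (\<forall>c\<in>A. \<forall>p \<in> U \<inter> chart_dom c.
           nabla A \<Gamma> X (\<lambda>c p. \<phi> c p (Y c p)) c p - \<phi> c p (nabla A \<Gamma> X Y c p) =
             (f1 p - f3 p) *\<^sub>R (g c p (X c p) (Y c p) *\<^sub>R \<xi> c p - \<eta> c p (Y c p) *\<^sub>R X c p))"
    using gssf unfolding gen_sasakian_space_form_def by (elim conjE)
  have "nabla A \<Gamma> ?X (\<lambda>c p. \<phi> c p (?Y c p)) a p - \<phi> a p (nabla A \<Gamma> ?X ?Y a p) =
      (f1 p - f3 p) *\<^sub>R (g a p (?X a p) (?Y a p) *\<^sub>R \<xi> a p - \<eta> a p (?Y a p) *\<^sub>R ?X a p)"
    by (rule *[rule_format, OF conjI[OF cf cf] a(1)]) (simp add: a)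
  moreover have "dir_deriv A ?X (\<lambda>p. \<phi> a p (?Y a p)) p = chart_deriv a (\<lambda>p. \<phi> a p y) p x"
    using amb.dir_deriv_cong[OF amb.openin_chart[OF a(1)] a(2), of "\<lambda>p. \<phi> a p (?Y a p)" "\<lambda>p. \<phi> a p y"]
      amb.dir_deriv_eq[OF cf a(2,1,2) phi_diff[OF a]] amb.coord_field_self[OF a(1)] a(2) by simp
  ultimately show ?thesis
    using amb.nabla_coord_field[OF a] amb.coord_field_self[OF a]
    by (simp add: nabla_def f_def algebra_simps)
qed

section \<open>The differential of the immersion and the pullback connection\<close>

definition J :: "('b, 'f) chart \<Rightarrow> ('a, 'e) chart \<Rightarrow> 'b \<Rightarrow> 'f \<Rightarrow> 'e" where
  "J b a q = chart_deriv b (coord a \<circ> \<iota>) q"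

definition dom_along :: "('a, 'e) chart \<Rightarrow> 'b set" where
  "dom_along a = {q \<in> topspace S. \<iota> q \<in> chart_dom a}"

lemma dom_along: "q \<in> dom_along a \<Longrightarrow> \<iota> q \<in> chart_dom a"
  by (simp add: dom_along_def)

lemma dom_alongI: "b \<in> B \<Longrightarrow> q \<in> chart_dom b \<Longrightarrow> \<iota> q \<in> chart_dom a \<Longrightarrow> q \<in> dom_along a"
  by (simp add: dom_along_def sub.in_topspace)

lemma openin_dom_along: "a \<in> A \<Longrightarrow> openin S (dom_along a)"
proof -
  have "continuous_map S T \<iota>" using immersion unfolding immersion_def by (elim conjE)
  then show "a \<in> A \<Longrightarrow> openin S (dom_along a)"
    unfolding dom_along_def by (rule openin_continuous_map_preimage[OF _ amb.openin_chart])
qed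

lemma smooth_iota: "a \<in> A \<Longrightarrow> smooth_fun B (dom_along a) (coord a \<circ> \<iota>)"
  using immersion unfolding immersion_def dom_along_def by blast

lemma iota_diff: "b \<in> B \<Longrightarrow> a \<in> A \<Longrightarrow> q \<in> chart_dom b \<Longrightarrow> \<iota> q \<in> chart_dom a \<Longrightarrow> chart_diff b (coord a \<circ> \<iota>) q"
  by (rule sub.smooth_fun_diff[OF smooth_iota _ dom_alongI])

lemma linear_J: "b \<in> B \<Longrightarrow> a \<in> A \<Longrightarrow> q \<in> chart_dom b \<Longrightarrow> \<iota> q \<in> chart_dom a \<Longrightarrow> linear (J b a q)"
  unfolding J_def by (rule linear_chart_deriv[OF iota_diff])

lemma inj_J: "b \<in> B \<Longrightarrow> a \<in> A \<Longrightarrow> q \<in> chart_dom b \<Longrightarrow> \<iota> q \<in> chart_dom a \<Longrightarrow> inj (J b a q)"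
  using immersion unfolding immersion_def J_def by blast

lemma iota_compose:
  assumes "b \<in> B" "a \<in> A" "q \<in> chart_dom b" "\<iota> q \<in> chart_dom a" "chart_diff a F (\<iota> q)"
  shows "chart_diff b (\<lambda>q. F (\<iota> q)) q"
    "chart_deriv b (\<lambda>q. F (\<iota> q)) q v = chart_deriv a F (\<iota> q) (J b a q v)"
proof -
  have "\<forall>\<^sub>F u in nhds (coord b q). chart_inv a (coord a (\<iota> (chart_inv b u))) = \<iota> (chart_inv b u)"
    using sub.eventually_chart[OF assms(1) openin_dom_along[OF assms(2)] dom_alongI[OF assms(1,3,4)] assms(3)]
    by eventually_elim (simp add: amb.chart_inv_coord[OF assms(2) dom_along])
  from chart_deriv_compose[OF sub.chart_inv_coord[OF assms(1,3)] this iota_diff[OF assms(1-4)] assms(5)]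
  show "chart_diff b (\<lambda>q. F (\<iota> q)) q"
    "chart_deriv b (\<lambda>q. F (\<iota> q)) q v = chart_deriv a F (\<iota> q) (J b a q v)"
    unfolding J_def by auto
qed

lemma J_change_amb:
  assumes "b \<in> B" "a \<in> A" "a' \<in> A" "q \<in> chart_dom b" "\<iota> q \<in> chart_dom a" "\<iota> q \<in> chart_dom a'"
  shows "J b a' q v = chart_deriv a (coord a') (\<iota> q) (J b a q v)"
  using iota_compose(2)[OF assms(1,2,4,5) amb.coord_diff[OF assms(2,3,5,6)]]
  by (simp add: J_def comp_def)

lemma J_change_sub:
  assumes "b \<in> B" "c \<in> B" "a \<in> A" "q \<in> chart_dom b" "q \<in> chart_dom c" "\<iota> q \<in> chart_dom a"
  shows "J c a q v = J b a q (chart_deriv c (coord b) q v)"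
  unfolding J_def by (rule sub.chart_change(2)[OF assms(2,1,5,4) iota_diff[OF assms(1,3,4,6)]])

text \<open>A change of chart on the submanifold composes \<open>J\<close> with a Jacobian on the
  right, so every chart gives vectors in the range of the chosen one.\<close>

lemma tangent_space_eq:
  assumes "b \<in> B" "a \<in> A" "q \<in> chart_dom b" "\<iota> q \<in> chart_dom a"
  shows "tangent_space B \<iota> a q = range (J b a q)"
proof
  show "tangent_space B \<iota> a q \<subseteq> range (J b a q)"
    unfolding tangent_space_def J_def[symmetric]
    using J_change_sub[OF assms(1) _ assms(2,3) _ assms(4)] by blast
  show "range (J b a q) \<subseteq> tangent_space B \<iota> a q"
    unfolding tangent_space_def J_def using assms by blast
qed

lemma push_eq:
  assumes "smooth_vector_field S B V X" "q \<in> V" "b \<in> B" "q \<in> chart_dom b" "a \<in> A" "\<iota> q \<in> chart_dom a"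
  shows "push B \<iota> X a q = J b a q (X b q)"
  unfolding push_def J_def
  by (rule sub.dir_deriv_eq[OF assms(1-4) iota_diff[OF assms(3,5,4,6)]])

lemma smooth_J:
  assumes b: "b \<in> B" and a: "a \<in> A"
  shows "smooth_on (coord b ` (dom_along a \<inter> chart_dom b)) ((\<lambda>q. J b a q y) \<circ> chart_inv b)"
  unfolding smooth_on_def
proof
  fix k
  let ?D = "coord b ` (dom_along a \<inter> chart_dom b)"
  have "Ck_on (Suc k) ?D (coord a \<circ> \<iota> \<circ> chart_inv b)"
    using smooth_iota[OF a] b unfolding smooth_fun_def smooth_on_def by blast
  then have "Ck_on k ?D (\<lambda>u. frechet_derivative (coord a \<circ> \<iota> \<circ> chart_inv b) (at u) y)" by simp
  then show "Ck_on k ?D ((\<lambda>q. J b a q y) \<circ> chart_inv b)"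
  proof (rule Ck_on_cong[OF sub.open_coord_image_Int[OF b openin_dom_along[OF a]], THEN iffD1, rotated])
    show "frechet_derivative (coord a \<circ> \<iota> \<circ> chart_inv b) (at u) y = ((\<lambda>q. J b a q y) \<circ> chart_inv b) u"
      if "u \<in> ?D" for u
      using sub.chart_inv_image(2)[OF b that] by (simp add: J_def chart_deriv_def)
  qed
qed

lemma J_diff:
  assumes "b \<in> B" "a \<in> A" "q \<in> chart_dom b" "\<iota> q \<in> chart_dom a"
  shows "chart_diff b (\<lambda>q. J b a q y) q"
proof -
  have "Ck_on (Suc 0) (coord b ` (dom_along a \<inter> chart_dom b)) ((\<lambda>q. J b a q y) \<circ> chart_inv b)"
    using smooth_J[OF assms(1,2)] unfolding smooth_on_def by blast
  moreover have "coord b q \<in> coord b ` (dom_along a \<inter> chart_dom b)"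
    using dom_alongI[OF assms(1,3,4)] assms(3) by blast
  ultimately show ?thesis unfolding Ck_on.simps chart_diff_def by blast
qed

text \<open>The pullback connection, read in the charts \<open>b\<close> and \<open>a\<close>.\<close>
definition D :: "('b, 'f) chart \<Rightarrow> ('a, 'e) chart \<Rightarrow> 'b \<Rightarrow> 'f \<Rightarrow> ('b \<Rightarrow> 'e) \<Rightarrow> 'e" where
  "D b a q x w = chart_deriv b w q x + \<Gamma> a (\<iota> q) (J b a q x) (w q)"

lemma D_cong:
  assumes "b \<in> B" "openin S W" "q \<in> W" "q \<in> chart_dom b" "\<And>q. q \<in> W \<Longrightarrow> q \<in> chart_dom b \<Longrightarrow> w q = w' q"
  shows "D b a q x w = D b a q x w'"
  unfolding D_def using sub.chart_cong(2)[OF assms] assms(3-5) by simp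

context
  fixes b a q
  assumes b: "b \<in> B" and a: "a \<in> A" and q: "q \<in> chart_dom b" and iq: "\<iota> q \<in> chart_dom a"
begin

private lemmas bq = b openin_dom_along[OF a] dom_alongI[OF b q iq] q

lemma nabla_along_eq:
  assumes "smooth_vector_field S B V X" "q \<in> V" "chart_diff b (W a) q"
  shows "nabla_along B \<iota> \<Gamma> X W a q = D b a q (X b q) (W a)"
  unfolding nabla_along_def D_def
  using sub.dir_deriv_eq[OF assms(1,2) b q assms(3)] push_eq[OF assms(1,2) b q a iq] by simp

text \<open>The chain rule reduces the derivative of \<open>g\<close> along the immersion to
  \<open>nabla_g\<close> in the direction \<open>J b a q x\<close>; the resulting Christoffel terms
  complete the derivatives of components to \<open>D\<close>.\<close>

lemma D_g:
  assumes "chart_diff b w q" "chart_diff b w' q"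
  shows "chart_deriv b (\<lambda>q. g a (\<iota> q) (w q) (w' q)) q x =
    g a (\<iota> q) (D b a q x w) (w' q) + g a (\<iota> q) (w q) (D b a q x w')"
proof -
  have bil: "bilinear (g a (\<iota> p))" if "p \<in> dom_along a" for p
    by (rule bilinear_g[OF a dom_along[OF that]])
  note comp = iota_compose[OF b a q iq g_diff[OF a iq]]
  have "chart_deriv b (\<lambda>q. g a (\<iota> q) (w q) (w' q)) q x =
      chart_deriv b (\<lambda>q'. g a (\<iota> q') (w q) (w' q)) q x +
      g a (\<iota> q) (chart_deriv b w q x) (w' q) + g a (\<iota> q) (w q) (chart_deriv b w' q x)"
    by (rule sub.chart_deriv_bilinear_apply(2)[where P = "\<lambda>q. g a (\<iota> q)", OF bq bil comp(1) assms])
  moreover note comp(2)[of "w q" "w' q" x] nabla_g[OF a iq, of "w q" "w' q" "J b a q x"]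
  ultimately show ?thesis
    unfolding D_def by (simp add: bilinear_ladd[OF bilinear_g[OF a iq]] bilinear_radd[OF bilinear_g[OF a iq]])
qed

lemma D_phi:
  assumes "chart_diff b w q"
  shows "chart_diff b (\<lambda>q. \<phi> a (\<iota> q) (w q)) q"
    "D b a q x (\<lambda>q. \<phi> a (\<iota> q) (w q)) = \<phi> a (\<iota> q) (D b a q x w) +
      f (\<iota> q) *\<^sub>R (g a (\<iota> q) (J b a q x) (w q) *\<^sub>R \<xi> a (\<iota> q) - \<eta> a (\<iota> q) (w q) *\<^sub>R J b a q x)"
proof -
  have lin: "linear (\<phi> a (\<iota> p))" if "p \<in> dom_along a" for p
    by (rule linear_phi[OF a dom_along[OF that]])
  note comp = iota_compose[OF b a q iq phi_diff[OF a iq]]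
  note der = sub.chart_deriv_linear_apply[where L = "\<lambda>q. \<phi> a (\<iota> q)", OF bq lin comp(1) assms]
  show "chart_diff b (\<lambda>q. \<phi> a (\<iota> q) (w q)) q" by (rule der(1))
  show "D b a q x (\<lambda>q. \<phi> a (\<iota> q) (w q)) = \<phi> a (\<iota> q) (D b a q x w) +
      f (\<iota> q) *\<^sub>R (g a (\<iota> q) (J b a q x) (w q) *\<^sub>R \<xi> a (\<iota> q) - \<eta> a (\<iota> q) (w q) *\<^sub>R J b a q x)"
    using nabla_phi[OF a iq, of "w q" "J b a q x"] comp(2)[of "w q" x] der(2)[of x]
    unfolding D_def by (simp add: linear_add[OF linear_phi[OF a iq]])
qed

lemma D_xi:
  shows "chart_diff b (\<lambda>q. \<xi> a (\<iota> q)) q"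
    "D b a q x (\<lambda>q. \<xi> a (\<iota> q)) = - (f (\<iota> q) *\<^sub>R \<phi> a (\<iota> q) (J b a q x))"
  using iota_compose[OF b a q iq xi_diff[OF a iq]] nabla_xi[OF a iq] by (auto simp: D_def)

lemma D_scaleR:
  assumes "chart_diff b F q" "chart_diff b w q"
  shows "D b a q x (\<lambda>q. F q *\<^sub>R w q) = chart_deriv b F q x *\<^sub>R w q + F q *\<^sub>R D b a q x w"
  using chart_deriv_scaleR[OF assms sub.chart_inv_coord[OF b q], of x]
  by (simp add: D_def bilinear_rmul[OF amb.bilinear_christoffel[OF a iq]] algebra_simps)

end

section \<open>The second fundamental form: Gauss formula, symmetry, normality\<close>

text \<open>The second fundamental form as a pointwise bilinear map, which makes its tensoriality explicit.\<close>
definition H :: "('b, 'f) chart \<Rightarrow> ('a, 'e) chart \<Rightarrow> 'b \<Rightarrow> 'f \<Rightarrow> 'f \<Rightarrow> 'e" where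
  "H b a q x y = D b a q x (\<lambda>q. J b a q y) - J b a q (\<Gamma>M b q x y)"

lemma push_diff:
  assumes Y: "smooth_vector_field S B V Y" and q: "q \<in> V"
    and b: "b \<in> B" "q \<in> chart_dom b" and a: "a \<in> A" "\<iota> q \<in> chart_dom a"
  shows "chart_diff b (push B \<iota> Y a) q"
    and "chart_deriv b (push B \<iota> Y a) q x =
      chart_deriv b (\<lambda>q'. J b a q' (Y b q)) q x + J b a q (chart_deriv b (Y b) q x)"
proof -
  let ?W = "V \<inter> dom_along a"
  have W: "openin S ?W" "q \<in> ?W"
    using sub.vector_field_openin[OF Y] openin_dom_along[OF a(1)] q dom_alongI[OF b a(2)] by auto
  have eq: "push B \<iota> Y a p = J b a p (Y b p)" if "p \<in> ?W" "p \<in> chart_dom b" for p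
    using that dom_along by (intro push_eq[OF Y _ b(1) _ a(1)]) auto
  have lin: "linear (J b a p)" if "p \<in> ?W" "p \<in> chart_dom b" for p
    using that dom_along by (intro linear_J b a) auto
  have cong: "chart_diff b (push B \<iota> Y a) q \<longleftrightarrow> chart_diff b (\<lambda>p. J b a p (Y b p)) q"
    "chart_deriv b (push B \<iota> Y a) q = chart_deriv b (\<lambda>p. J b a p (Y b p)) q"
    by (rule sub.chart_cong[OF b(1) W b(2)]; rule eq; assumption)+
  note diff = J_diff[OF b(1) a(1) b(2) a(2)] sub.vector_field_diff[OF Y b(1) b(1) q b(2) b(2)]
  have "chart_diff b (\<lambda>p. J b a p (Y b p)) q"
    by (rule sub.chart_deriv_linear_apply(1)[where L = "J b a", OF b(1) W b(2) lin diff])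
  then show "chart_diff b (push B \<iota> Y a) q" using cong(1) by blast
  have "chart_deriv b (\<lambda>p. J b a p (Y b p)) q x =
      chart_deriv b (\<lambda>q'. J b a q' (Y b q)) q x + J b a q (chart_deriv b (Y b) q x)"
    by (rule sub.chart_deriv_linear_apply(2)[where L = "J b a", OF b(1) W b(2) lin diff])
  then show "chart_deriv b (push B \<iota> Y a) q x =
      chart_deriv b (\<lambda>q'. J b a q' (Y b q)) q x + J b a q (chart_deriv b (Y b) q x)"
    using cong(2) by simp
qed

text \<open>Gauss formula. The derivative of the components of \<open>Y\<close> enters only through
  \<open>J\<close>, hence tangentially; what remains depends on the value of \<open>Y\<close> at
  \<open>q\<close> alone.\<close>

lemma D_push:
  assumes X: "smooth_vector_field S B V X" and Y: "smooth_vector_field S B V Y" and q: "q \<in> V"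
    and b: "b \<in> B" "q \<in> chart_dom b" and a: "a \<in> A" "\<iota> q \<in> chart_dom a"
  shows "D b a q (X b q) (push B \<iota> Y a) = J b a q (nabla B \<Gamma>M X Y b q) + H b a q (X b q) (Y b q)"
  unfolding D_def H_def push_diff(2)[OF Y q b a] sub.nabla_eq[OF X Y b(1) q b(2)]
    push_eq[OF Y q b a] linear_add[OF linear_J[OF b(1) a(1) b(2) a(2)]]
  by simp

lemma second_ff_eq:
  assumes X: "smooth_vector_field S B V X" and Y: "smooth_vector_field S B V Y" and q: "q \<in> V"
    and b: "b \<in> B" "q \<in> chart_dom b" and a: "a \<in> A" "\<iota> q \<in> chart_dom a"
  shows "second_ff B \<iota> \<Gamma> \<Gamma>M X Y a q = H b a q (X b q) (Y b q)"
  unfolding second_ff_def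
    nabla_along_eq[OF b(1) a(1) b(2) a(2) X q, of "push B \<iota> Y", OF push_diff(1)[OF Y q b a]]
    push_eq[OF sub.smooth_nabla[OF X Y] q b a] D_push[OF X Y q b a]
  by simp

context
  fixes b a q
  assumes b: "b \<in> B" and a: "a \<in> A" and q: "q \<in> chart_dom b" and iq: "\<iota> q \<in> chart_dom a"
begin

text \<open>Up to two Christoffel terms, each symmetric, \<open>H\<close> is the second derivative
  of the immersion in coordinates.\<close>

lemma H_sym: "H b a q x y = H b a q y x"
proof -
  let ?F = "coord a \<circ> \<iota> \<circ> chart_inv b" and ?D = "coord b ` (dom_along a \<inter> chart_dom b)"
  have op: "open ?D" by (rule sub.open_coord_image_Int[OF b openin_dom_along[OF a]])
  have q': "coord b q \<in> ?D" using dom_alongI[OF b q iq] q by blast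
  have D2: "chart_deriv b (\<lambda>q. J b a q v) q u = frechet_derivative (\<lambda>z. frechet_derivative ?F (at z) v) (at (coord b q)) u" for u v
    unfolding chart_deriv_def J_def
  proof (rule fun_cong[OF frechet_derivative_cong[OF op q']])
    show "((\<lambda>q. frechet_derivative ?F (at (coord b q)) v) \<circ> chart_inv b) z = frechet_derivative ?F (at z) v"
      if "z \<in> ?D" for z
      using sub.chart_inv_image(2)[OF b that] by simp
  qed
  have smooth: "Ck_on k ?D ?F" for k
    using smooth_iota[OF a] b unfolding smooth_fun_def smooth_on_def by blast
  have "chart_deriv b (\<lambda>q. J b a q y) q x = chart_deriv b (\<lambda>q. J b a q x) q y"
    unfolding D2 by (rule second_derivative_symmetric[OF op q' smooth])
  then show ?thesis
    unfolding H_def D_def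
    using amb.christoffel_sym[OF a iq, of "J b a q x"] sub.christoffel_sym[OF b q, of x] by simp
qed

lemma linear_H_left: "linear (\<lambda>x. H b a q x y)"
  unfolding H_def D_def
  by (intro linear_compose_sub linear_compose_add linear_chart_deriv[OF J_diff[OF b a q iq]]
      linear_compose[OF linear_J[OF b a q iq] bilinear_left[OF amb.bilinear_christoffel[OF a iq]], unfolded comp_def]
      linear_compose[OF bilinear_left[OF sub.bilinear_christoffel[OF b q]] linear_J[OF b a q iq], unfolded comp_def])

lemma linear_H: "linear (H b a q x)"
proof -
  have "H b a q x = (\<lambda>y. H b a q y x)" using H_sym by blast
  then show ?thesis using linear_H_left by simp
qed

text \<open>The trilinear form \<open>t x y z = g (H x y) (J z)\<close> is symmetric in \<open>x, y\<close> and, by compatibility of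
  both connections with the metrics, antisymmetric in \<open>y, z\<close>; hence it vanishes.\<close>
lemma H_normal:
  assumes "b = chart_at B q"
  shows "g a (\<iota> q) (H b a q x y) (J b a q z) = 0"
proof -
  let ?g = "g a (\<iota> q)" and ?J = "J b a q"
  note bil = bilinear_g[OF a iq]
  have gM: "gM b p y z = g a (\<iota> p) (J b a p y) (J b a p z)"
    if "p \<in> dom_along a" "p \<in> chart_dom b" for p y z
    using induced b a that dom_along[OF that(1)] unfolding induced_metric_def J_def by blast
  have anti: "?g (H b a q x y) (?J z) + ?g (?J y) (H b a q x z) = 0" for x y z
  proof -
    \<comment> \<open>Since \<open>b\<close> is the chart selected by \<open>chart_at\<close>,
      \<open>dir_deriv\<close> unfolds to the derivative in \<open>b\<close> itself. This is the
      reason for the assumption on \<open>b\<close>.\<close>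
    have "chart_deriv b (\<lambda>q. gM b q y z) q x = gM b q (\<Gamma>M b q x y) z + gM b q y (\<Gamma>M b q x z)"
      using sub.metric_christoffel[OF b q, of x y z] sub.coord_field_self[OF b q]
      by (simp add: dir_deriv_def flip: assms)
    moreover have "chart_deriv b (\<lambda>q. gM b q y z) q x = chart_deriv b (\<lambda>q. g a (\<iota> q) (J b a q y) (J b a q z)) q x"
      by (rule fun_cong[OF sub.chart_cong(2)[OF b openin_dom_along[OF a] dom_alongI[OF b q iq] q gM]])
    moreover note gM[OF dom_alongI[OF b q iq] q] D_g[OF b a q iq J_diff[OF b a q iq] J_diff[OF b a q iq]]
    ultimately have "?g (?J (\<Gamma>M b q x y)) (?J z) + ?g (?J y) (?J (\<Gamma>M b q x z)) =
        ?g (D b a q x (\<lambda>q. J b a q y)) (?J z) + ?g (?J y) (D b a q x (\<lambda>q. J b a q z))" by simp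
    then show ?thesis unfolding H_def by (simp add: bilinear_lsub[OF bil] bilinear_rsub[OF bil])
  qed
  define t where "t x y z = ?g (H b a q x y) (?J z)" for x y z
  have "t x y z = - t x z y" for x y z
    using anti[of x y z] g_sym[OF a iq, of "?J y" "H b a q x z"] by (simp add: t_def)
  moreover have "t x y z = t y x z" for x y z unfolding t_def by (simp add: H_sym[of x y])
  \<comment> \<open>Alternating the two rules: txyz = -txzy = -tzxy = tzyx = tyzx = -tyxz =
    -txyz.\<close>
  ultimately have "t x y z = - t x y z" by metis
  then show ?thesis by (simp add: t_def)
qed

end

section \<open>The structure vector field on the submanifold\<close>

lemma iota_in_topspace:
  assumes "b \<in> B" "q \<in> chart_dom b"
  shows "\<iota> q \<in> topspace T"
proof -
  have "continuous_map S T \<iota>" using immersion unfolding immersion_def by (elim conjE)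
  then show ?thesis using sub.in_topspace[OF assms] by (auto simp: continuous_map_def)
qed

lemma invariantD:
  assumes "b \<in> B" "a \<in> A" "q \<in> chart_dom b" "\<iota> q \<in> chart_dom a"
  shows "\<xi> a (\<iota> q) \<in> range (J b a q)" "\<phi> a (\<iota> q) (J b a q x) \<in> range (J b a q)"
proof -
  have "\<xi> a (\<iota> q) \<in> tangent_space B \<iota> a q"
    "\<phi> a (\<iota> q) ` tangent_space B \<iota> a q \<subseteq> tangent_space B \<iota> a q"
    using invariant assms(2,4) sub.in_topspace[OF assms(1,3)] unfolding invariant_submanifold_def by blast+
  then show "\<xi> a (\<iota> q) \<in> range (J b a q)" "\<phi> a (\<iota> q) (J b a q x) \<in> range (J b a q)"
    unfolding tangent_space_eq[OF assms] by blast+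
qed

text \<open>The field of \<open>M\<close> that the immersion maps to \<xi>. Quantifying over all
  ambient charts avoids a choice of \<open>a\<close>; invariance gives existence, injectivity of
  \<open>J\<close> uniqueness.\<close>

definition \<xi>M :: "('b, 'f) field" where
  "\<xi>M b q = (THE x. \<forall>a\<in>A. \<iota> q \<in> chart_dom a \<longrightarrow> J b a q x = \<xi> a (\<iota> q))"

lemma J_xiM:
  assumes "b \<in> B" "a \<in> A" "q \<in> chart_dom b" "\<iota> q \<in> chart_dom a"
  shows "J b a q (\<xi>M b q) = \<xi> a (\<iota> q)"
proof -
  obtain x where x: "J b a q x = \<xi> a (\<iota> q)" using invariantD(1)[OF assms] by (metis imageE)
  have "\<forall>a\<in>A. \<iota> q \<in> chart_dom a \<longrightarrow> J b a q (\<xi>M b q) = \<xi> a (\<iota> q)"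
    unfolding \<xi>M_def
  proof (rule theI)
    show "\<forall>a\<in>A. \<iota> q \<in> chart_dom a \<longrightarrow> J b a q x = \<xi> a (\<iota> q)"
    proof (intro ballI impI)
      \<comment> \<open>A preimage found in one ambient chart works in all of them, because
        \<open>J\<close> and \<xi> transform by the same Jacobian.\<close>
      fix a' assume a': "a' \<in> A" "\<iota> q \<in> chart_dom a'"
      show "J b a' q x = \<xi> a' (\<iota> q)"
        unfolding J_change_amb[OF assms(1,2) a'(1) assms(3,4) a'(2)] x
        by (rule amb.vector_field_transform[OF smooth_xi assms(2) a'(1)
              iota_in_topspace[OF assms(1,3)] assms(4) a'(2), symmetric])
    qed
    show "y = x" if "\<forall>a\<in>A. \<iota> q \<in> chart_dom a \<longrightarrow> J b a q y = \<xi> a (\<iota> q)" for y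
      using that assms(2,4) x injD[OF inj_J[OF assms], of y x] by simp
  qed
  then show ?thesis using assms(2,4) by blast
qed

text \<open>In charts \<xi>M solves a linear system with matrix \<open>J\<close> and right-hand side
  \<xi> along the immersion. Both are smooth and the matrix is injective, so
  \<open>Ck_on_solve_injective\<close> applies.\<close>

lemma smooth_xiM: "smooth_vector_field S B (topspace S) \<xi>M"
  unfolding smooth_vector_field_def
proof (intro conjI ballI)
  show "smooth_fun B (topspace S \<inter> chart_dom b) (\<xi>M b)" if b: "b \<in> B" for b
  proof (rule sub.smooth_funI[OF b sub.openin_Int_chart[OF b openin_topspace]])
    show "smooth_on (coord b ` (topspace S \<inter> chart_dom b)) (\<xi>M b \<circ> chart_inv b)"
      unfolding smooth_on_def
    proof (intro allI Ck_on_local)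
      fix k z assume "z \<in> coord b ` (topspace S \<inter> chart_dom b)"
      then obtain q where q: "q \<in> chart_dom b" "z = coord b q" by blast
      define a where "a = chart_at A (\<iota> q)"
      have a: "a \<in> A" "\<iota> q \<in> chart_dom a"
        unfolding a_def by (rule amb.chart_at[OF iota_in_topspace[OF b q(1)]])+
      \<comment> \<open>On \<open>?U\<close> the immersion stays in the single ambient chart
        \<open>a\<close>; such sets cover the chart \<open>b\<close>.\<close>
      let ?U = "coord b ` (dom_along a \<inter> chart_dom b)"
      have U: "open ?U" by (rule sub.open_coord_image_Int[OF b openin_dom_along[OF a(1)]])
      have inv: "chart_inv b u \<in> chart_dom b" "\<iota> (chart_inv b u) \<in> chart_dom a" if "u \<in> ?U" for u
        using sub.chart_inv_image(1)[OF b that] dom_along by auto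
      have smooth_J: "Ck_on k ?U (\<lambda>u. J b a (chart_inv b u) y)" for k y
        using smooth_J[OF b a(1)] unfolding smooth_on_def comp_def by blast
      have smooth_xi: "Ck_on k ?U (\<lambda>u. (\<xi> a \<circ> chart_inv a) ((coord a \<circ> \<iota> \<circ> chart_inv b) u))"
      proof (rule Ck_on_compose[where F = "\<xi> a \<circ> chart_inv a" and G = "coord a \<circ> \<iota> \<circ> chart_inv b", OF U])
        show "open (coord a ` chart_dom a)"
          by (rule amb.open_coord_image[OF a(1) amb.openin_chart[OF a(1)] order_refl])
        have "smooth_fun A (chart_dom a \<inter> chart_dom a) (\<xi> a)"
          using smooth_xi_chart[OF a(1)] a(1) unfolding smooth_vector_field_def by blast
        then show "Ck_on k (coord a ` chart_dom a) (\<xi> a \<circ> chart_inv a)"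
          using a(1) unfolding smooth_fun_def smooth_on_def by force
        show "Ck_on k ?U (coord a \<circ> \<iota> \<circ> chart_inv b)"
          using smooth_iota[OF a(1)] b unfolding smooth_fun_def smooth_on_def by blast
        show "(coord a \<circ> \<iota> \<circ> chart_inv b) ` ?U \<subseteq> coord a ` chart_dom a"
          using inv(2) by auto
      qed
      have "Ck_on k ?U (\<xi>M b \<circ> chart_inv b)"
      proof (rule Ck_on_solve_injective[OF U _ _ smooth_J smooth_xi])
        show "linear (J b a (chart_inv b u))" "inj (J b a (chart_inv b u))" if "u \<in> ?U" for u
          by (rule linear_J[OF b a(1) inv[OF that]] inj_J[OF b a(1) inv[OF that]])+
        show "J b a (chart_inv b u) ((\<xi>M b \<circ> chart_inv b) u) =
            (\<xi> a \<circ> chart_inv a) ((coord a \<circ> \<iota> \<circ> chart_inv b) u)" if "u \<in> ?U" for u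
          using J_xiM[OF b a(1) inv[OF that]] amb.chart_inv_coord[OF a(1) inv(2)[OF that]] by simp
      qed
      moreover have "z \<in> ?U" using q dom_alongI[OF b q(1) a(2)] by blast
      ultimately show "\<exists>U. open U \<and> z \<in> U \<and> Ck_on k U (\<xi>M b \<circ> chart_inv b)" using U by blast
    qed
  qed simp
  show "\<xi>M d q = chart_deriv c (coord d) q (\<xi>M c q)"
    if c: "c \<in> B" and d: "d \<in> B" and q: "q \<in> topspace S \<inter> chart_dom c \<inter> chart_dom d" for c d q
  proof -
    have qc: "q \<in> chart_dom c" and qd: "q \<in> chart_dom d" using q by auto
    define a where "a = chart_at A (\<iota> q)"
    have a: "a \<in> A" "\<iota> q \<in> chart_dom a"
      unfolding a_def by (rule amb.chart_at[OF iota_in_topspace[OF c qc]])+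
    \<comment> \<open>The transformation law is checked after applying the injective map
      \<open>J d a q\<close>, where both sides become \<xi>.\<close>
    have "J d a q (\<xi>M d q) = J d a q (chart_deriv c (coord d) q (\<xi>M c q))"
      using J_xiM[OF d a(1) qd a(2)] J_xiM[OF c a(1) qc a(2)] J_change_sub[OF d c a(1) qd qc a(2)] by simp
    then show ?thesis by (rule injD[OF inj_J[OF d a(1) qd a(2)]])
  qed
qed simp

lemma smooth_xiM_open: "openin S V \<Longrightarrow> smooth_vector_field S B V \<xi>M"
  by (rule sub.vector_field_subset[OF smooth_xiM _ openin_subset])

lemma push_xiM: "q \<in> topspace S \<Longrightarrow> a \<in> A \<Longrightarrow> \<iota> q \<in> chart_dom a \<Longrightarrow> push B \<iota> \<xi>M a q = \<xi> a (\<iota> q)"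
  using push_eq[OF smooth_xiM] J_xiM sub.chart_at by metis

lemma D_push_xiM:
  assumes b: "b \<in> B" "q \<in> chart_dom b" and a: "a \<in> A" "\<iota> q \<in> chart_dom a"
  shows "D b a q x (push B \<iota> \<xi>M a) = - (f (\<iota> q) *\<^sub>R \<phi> a (\<iota> q) (J b a q x))"
proof -
  have "D b a q x (push B \<iota> \<xi>M a) = D b a q x (\<lambda>q. \<xi> a (\<iota> q))"
    by (rule D_cong[OF b(1) openin_dom_along[OF a(1)] dom_alongI[OF b a(2)] b(2)])
      (rule push_xiM, auto simp: dom_along_def a)
  then show ?thesis by (simp add: D_xi(2)[OF b(1) a(1) b(2) a(2)])
qed

context
  fixes b a q
  assumes b: "b = chart_at B q" and q: "q \<in> topspace S" and a: "a \<in> A" and iq: "\<iota> q \<in> chart_dom a"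
begin

private lemma bB: "b \<in> B" and qb: "q \<in> chart_dom b"
  unfolding b by (rule sub.chart_at[OF q])+

private lemmas lin = linear_J[OF bB a qb iq]

text \<open>\<open>H x \<xi>\<close> is normal, but also tangent since \<open>\<nabla>\<^sub>X \<xi>\<close> is.\<close>
lemma H_xiM: "H b a q x (\<xi>M b q) = 0"
proof -
  note X = sub.smooth_coord_field[OF bB] and xi = smooth_xiM_open[OF sub.openin_chart[OF bB]]
  let ?N = "nabla B \<Gamma>M (coord_field b x) \<xi>M b q"
  obtain y where y: "\<phi> a (\<iota> q) (J b a q x) = J b a q y"
    using invariantD(2)[OF bB a qb iq] by (metis imageE)
  have "J b a q ?N + H b a q x (\<xi>M b q) = - (f (\<iota> q) *\<^sub>R J b a q y)"
    using D_push[OF X xi qb bB qb a iq, of x] D_push_xiM[OF bB qb a iq, of x]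
    by (simp add: sub.coord_field_self[OF bB qb] y)
  then have "H b a q x (\<xi>M b q) = J b a q (- (f (\<iota> q) *\<^sub>R y) - ?N)"
    by (simp add: linear_diff[OF lin] linear_neg[OF lin] linear_cmul[OF lin] algebra_simps)
  then have "g a (\<iota> q) (H b a q x (\<xi>M b q)) (H b a q x (\<xi>M b q)) = 0"
    using H_normal[OF bB a qb iq b] by metis
  then show ?thesis using g_pos[OF a iq] by fastforce
qed

text \<open>With the normal component removed by \<open>H_xiM\<close>, the ambient equation for the
  derivative of \<xi> descends to the connection of \<open>M\<close>.\<close>

lemma push_nabla_xiM:
  assumes X: "smooth_vector_field S B V X" and V: "q \<in> V"
  shows "push B \<iota> (nabla B \<Gamma>M X \<xi>M) a q = - (f (\<iota> q) *\<^sub>R \<phi> a (\<iota> q) (push B \<iota> X a q))"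
proof -
  note xi = smooth_xiM_open[OF sub.vector_field_openin[OF X]]
  show ?thesis
    using D_push[OF X xi V bB qb a iq] D_push_xiM[OF bB qb a iq] H_xiM
      push_eq[OF sub.smooth_nabla[OF X xi] V bB qb a iq] push_eq[OF X V bB qb a iq] by simp
qed

text \<open>The definite description has to be evaluated: a candidate that is both tangent and
  orthogonal to the tangent space is orthogonal to itself.\<close>

lemma normal_part_0: "normal_part B \<iota> g a q 0 = 0"
  unfolding normal_part_def tangent_space_eq[OF bB a qb iq]
proof (rule the_equality)
  have "0 = J b a q 0" by (simp add: linear_0[OF lin])
  then show "0 - 0 \<in> range (J b a q) \<and> (\<forall>t\<in>range (J b a q). g a (\<iota> q) 0 t = 0)"
    by (simp add: bilinear_lzero[OF bilinear_g[OF a iq]])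
next
  fix \<nu> assume \<nu>: "0 - \<nu> \<in> range (J b a q) \<and> (\<forall>t\<in>range (J b a q). g a (\<iota> q) \<nu> t = 0)"
  then have "g a (\<iota> q) \<nu> (0 - \<nu>) = 0" by blast
  then have "g a (\<iota> q) \<nu> \<nu> = 0" by (simp add: bilinear_rneg[OF bilinear_g[OF a iq]])
  then show "\<nu> = 0" using g_pos[OF a iq] by fastforce
qed

end

lemma nabla_perp_0:
  assumes V: "openin S V" "q \<in> V" and a: "a \<in> A" "\<iota> q \<in> chart_dom a"
    and N: "\<And>q. q \<in> V \<Longrightarrow> \<iota> q \<in> chart_dom a \<Longrightarrow> N a q = 0"
  shows "nabla_perp B \<iota> g \<Gamma> X N a q = 0"
proof -
  have q: "q \<in> topspace S" using V openin_subset by blast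
  have "openin S (V \<inter> dom_along a)" "q \<in> V \<inter> dom_along a"
    using V openin_dom_along[OF a(1)] a(2) q by (auto simp: dom_along_def)
  then have "dir_deriv B X (N a) q = dir_deriv B X (\<lambda>q. 0) q"
    by (rule sub.dir_deriv_cong) (auto simp: N dom_along_def)
  then have "nabla_along B \<iota> \<Gamma> X N a q = 0"
    unfolding nabla_along_def
    by (simp add: N V a bilinear_rzero[OF amb.bilinear_christoffel[OF a]])
  then show ?thesis unfolding nabla_perp_def by (simp add: normal_part_0[OF refl q a])
qed

text \<open>Vanishing is required on an open set because \<open>N\<close> is differentiated twice.
  It serves both implications: once for h = 0, once for h(Z, \<xi>) = 0.\<close>

lemma normal_curvature_0:
  assumes V: "openin S V" "q \<in> V" and a: "a \<in> A" "\<iota> q \<in> chart_dom a"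
    and N: "\<And>q. q \<in> V \<Longrightarrow> \<iota> q \<in> chart_dom a \<Longrightarrow> N a q = 0"
  shows "normal_curvature B \<iota> g \<Gamma> X Y N a q = 0"
  unfolding normal_curvature_def
  by (simp add: nabla_perp_0[OF V(1) _ a(1)] V(2) a(2) N)

section \<open>Curvature of the submanifold in the direction of \<xi>\<close>

text \<open>The computation takes place after pushing forward by \<open>J\<close>, since \<phi> and
  \<open>f\<close> live on the ambient manifold. The scalar \<alpha> is the derivative of
  \<open>f\<close> along \<xi>.\<close>

lemma curvature_xiM:
  fixes x q
  defines "b \<equiv> chart_at B q"
  defines "X \<equiv> coord_field b x" and "\<alpha> \<equiv> chart_deriv b (\<lambda>q. f (\<iota> q)) q (\<xi>M b q)"
  assumes q: "q \<in> topspace S" and a: "a \<in> A" and iq: "\<iota> q \<in> chart_dom a"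
  shows "J b a q (curvature B \<Gamma>M X \<xi>M \<xi>M b q) =
    \<alpha> *\<^sub>R \<phi> a (\<iota> q) (J b a q x) + (f (\<iota> q))\<^sup>2 *\<^sub>R (J b a q x - \<eta> a (\<iota> q) (J b a q x) *\<^sub>R \<xi> a (\<iota> q))"
proof -
  have b: "b \<in> B" "q \<in> chart_dom b" unfolding b_def by (rule sub.chart_at[OF q])+
  note lin = linear_J[OF b(1) a b(2) iq] and lphi = linear_phi[OF a iq]
  note X = sub.smooth_coord_field[OF b(1), of x, folded X_def]
    and xi = smooth_xiM_open[OF sub.openin_chart[OF b(1)]]
  let ?\<phi> = "\<phi> a (\<iota> q)" and ?f = "f (\<iota> q)" and ?J = "J b a q" and ?nab = "nabla B \<Gamma>M"
  have Xq: "X b q = x" unfolding X_def by (rule sub.coord_field_self[OF b])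
  have pushX: "push B \<iota> X a q = ?J x" using push_eq[OF X b(2) b a iq] Xq by simp
  \<comment> \<open>Hence differentiating a tangent field in the direction \<xi> gives a tangent
    field: the normal term of \<open>D_push\<close> disappears.\<close>
  have H0: "H b a q (\<xi>M b q) y = 0" for y
    using H_xiM[OF meta_eq_to_obj_eq[OF b_def] q a iq, of y] H_sym[OF b(1) a b(2) iq, of y] by simp
  have in_S: "p \<in> topspace S" if "p \<in> chart_dom b" for p by (rule sub.in_topspace[OF b(1) that])

  \<comment> \<open>The curves of \<xi> are geodesics, as \<phi> annihilates \<xi>. This is needed
    on the whole chart because the field is differentiated again; \<open>\<iota> p\<close> may leave
    \<open>a\<close>, so each point uses its own ambient chart.\<close>
  have N1: "?nab \<xi>M \<xi>M b p = 0" if p: "p \<in> chart_dom b" for p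
  proof -
    define a' where "a' = chart_at A (\<iota> p)"
    have a': "a' \<in> A" "\<iota> p \<in> chart_dom a'"
      unfolding a'_def by (rule amb.chart_at[OF iota_in_topspace[OF b(1) p]])+
    have "J b a' p (?nab \<xi>M \<xi>M b p) = 0"
      using push_nabla_xiM[OF refl in_S[OF p] a' xi p] push_eq[OF sub.smooth_nabla[OF xi xi] p b(1) p a']
        push_xiM[OF in_S[OF p] a'] acm_pointwise(2)[OF a'] by simp
    then have "J b a' p (?nab \<xi>M \<xi>M b p) = J b a' p 0"
      by (simp add: linear_0[OF linear_J[OF b(1) a'(1) p a'(2)]])
    then show ?thesis by (rule injD[OF inj_J[OF b(1) a'(1) p a'(2)]])
  qed
  have first: "?nab X (?nab \<xi>M \<xi>M) b q = 0"
  proof -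
    have "chart_deriv b (?nab \<xi>M \<xi>M b) q = chart_deriv b (\<lambda>p. 0) q"
      by (rule sub.chart_cong(2)[OF b(1) sub.openin_chart[OF b(1)] b(2,2)]) (rule N1)
    then show ?thesis
      by (simp add: sub.nabla_eq[OF X sub.smooth_nabla[OF xi xi] b(1) b(2,2)] N1[OF b(2)]
          bilinear_rzero[OF sub.bilinear_christoffel[OF b]])
  qed

  \<comment> \<open>The product rule for \<open>- f\<close> times \<phi> X, differentiated along
    \<xi>, is the origin of the term with \<alpha>.\<close>
  have second: "?J (?nab \<xi>M (?nab X \<xi>M) b q) = - (\<alpha> *\<^sub>R ?\<phi> (?J x)) - ?f *\<^sub>R ?\<phi> (?J (?nab \<xi>M X b q))"
  proof -
    let ?w = "\<lambda>q. \<phi> a (\<iota> q) (push B \<iota> X a q)"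
    note dX = push_diff(1)[OF X b(2) b a iq]
    have df: "chart_diff b (\<lambda>q. f (\<iota> q)) q"
      by (rule iota_compose(1)[OF b(1) a b(2) iq f_diff[OF a iq]])
    have mf: "chart_diff b (\<lambda>q. - f (\<iota> q)) q" "chart_deriv b (\<lambda>q. - f (\<iota> q)) q v = - chart_deriv b (\<lambda>q. f (\<iota> q)) q v" for v
      using chart_diff_minus[OF chart_diff_const[of b 0 q] df] by auto
    have "?J (?nab \<xi>M (?nab X \<xi>M) b q) = D b a q (\<xi>M b q) (push B \<iota> (?nab X \<xi>M) a)"
      using D_push[OF xi sub.smooth_nabla[OF X xi] b(2) b a iq] H0 by simp
    also have "\<dots> = D b a q (\<xi>M b q) (\<lambda>q. (- f (\<iota> q)) *\<^sub>R ?w q)"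
    proof (rule D_cong[OF b(1) openin_dom_along[OF a] dom_alongI[OF b iq] b(2)])
      show "push B \<iota> (?nab X \<xi>M) a p = (- f (\<iota> p)) *\<^sub>R ?w p" if "p \<in> dom_along a" "p \<in> chart_dom b" for p
        using push_nabla_xiM[OF refl in_S[OF that(2)] a dom_along[OF that(1)] X that(2)] by simp
    qed
    also have "\<dots> = - (\<alpha> *\<^sub>R ?w q) - ?f *\<^sub>R D b a q (\<xi>M b q) ?w"
      using D_scaleR[OF b(1) a b(2) iq mf(1) D_phi(1)[OF b(1) a b(2) iq dX]] mf(2) by (simp add: \<alpha>_def)
    \<comment> \<open>The correction from the structure equation for \<phi> cancels in this
      direction: it is \<open>f\<close> times g(\<xi>, X) \<xi> - \<eta>(X) \<xi>.\<close>
    also have "D b a q (\<xi>M b q) ?w = ?\<phi> (D b a q (\<xi>M b q) (push B \<iota> X a))"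
      using D_phi(2)[OF b(1) a b(2) iq dX] J_xiM[OF b(1) a b(2) iq]
        g_sym[OF a iq, of "\<xi> a (\<iota> q)"] acm_pointwise(4)[OF a iq] by simp
    also have "D b a q (\<xi>M b q) (push B \<iota> X a) = ?J (?nab \<xi>M X b q)"
      using D_push[OF xi X b(2) b a iq] H0 by simp
    finally show ?thesis by (simp add: pushX)
  qed

  have third: "?J (?nab (lie_bracket B X \<xi>M) \<xi>M b q) =
      - (?f *\<^sub>R ?\<phi> (- (?f *\<^sub>R ?\<phi> (?J x)) - ?J (?nab \<xi>M X b q)))"
  proof -
    note br = sub.smooth_lie_bracket[OF X xi]
    have "?J (lie_bracket B X \<xi>M b q) = ?J (?nab X \<xi>M b q) - ?J (?nab \<xi>M X b q)"
      using sub.torsion_free[OF X xi b(1) b(2,2)] linear_diff[OF lin] by metis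
    moreover have "?J (?nab X \<xi>M b q) = - (?f *\<^sub>R ?\<phi> (?J x))"
      using push_nabla_xiM[OF refl q a iq X b(2)] push_eq[OF sub.smooth_nabla[OF X xi] b(2) b a iq] pushX by simp
    ultimately show ?thesis
      using push_nabla_xiM[OF refl q a iq br b(2)] push_eq[OF sub.smooth_nabla[OF br xi] b(2) b a iq]
        push_eq[OF br b(2) b a iq] by simp
  qed
  \<comment> \<open>The terms containing the derivative of X along \<xi> cancel between the second
    and third contributions.\<close>
  have "?J (curvature B \<Gamma>M X \<xi>M \<xi>M b q) = \<alpha> *\<^sub>R ?\<phi> (?J x) - ?f *\<^sub>R (?f *\<^sub>R ?\<phi> (?\<phi> (?J x)))"
    unfolding curvature_def linear_diff[OF lin] first second third
    by (simp add: linear_0[OF lin] linear_diff[OF lphi] linear_neg[OF lphi] linear_cmul[OF lphi] algebra_simps)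
  then show ?thesis
    by (simp add: acm_pointwise(1)[OF a iq] power2_eq_square algebra_simps)
qed

section \<open>The two implications\<close>

text \<open>Normality of \<open>H\<close> is available in the chart \<open>chart_at B q\<close>. As
  \<open>second_ff_eq\<close> allows any chart around \<open>q\<close>, this one is enough.\<close>

lemma semiparallel_imp_H_eq_0:
  assumes sp: "semiparallel S B A \<iota> g \<Gamma> \<Gamma>M" and f: "\<forall>p\<in>topspace T. f1 p \<noteq> f3 p"
    and q: "q \<in> topspace S" and a: "a \<in> A" and iq: "\<iota> q \<in> chart_dom a"
  shows "H (chart_at B q) a q z x = 0"
proof -
  define b where "b = chart_at B q"
  have b: "b \<in> B" "q \<in> chart_dom b" unfolding b_def by (rule sub.chart_at[OF q])+
  note lin = linear_J[OF b(1) a b(2) iq] and inj = inj_J[OF b(1) a b(2) iq]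
  note X = sub.smooth_coord_field[OF b(1)] and xi = smooth_xiM_open[OF sub.openin_chart[OF b(1)]]
  note lH = linear_H[OF b(1) a b(2) iq, of z]
  let ?\<phi> = "\<phi> a (\<iota> q)" and ?f = "f (\<iota> q)" and ?J = "J b a q" and ?H = "H b a q z"
  define \<alpha> where "\<alpha> = chart_deriv b (\<lambda>q. f (\<iota> q)) q (\<xi>M b q)"
  have H0: "H b a q y (\<xi>M b q) = 0" for y by (rule H_xiM[OF b_def q a iq])
  \<comment> \<open>The tangent vector \<open>y\<close> represents \<phi> X in the chart of
    \<open>M\<close>; it exists by invariance.\<close>
  have key: "\<alpha> *\<^sub>R ?H y + ?f\<^sup>2 *\<^sub>R ?H x = 0" if y: "?J y = ?\<phi> (?J x)" for x y
  proof -
    let ?R = "curvature B \<Gamma>M (coord_field b x) \<xi>M"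
    let ?K = "?R \<xi>M b q"
    have "normal_curvature B \<iota> g \<Gamma> (coord_field b x) \<xi>M (second_ff B \<iota> \<Gamma> \<Gamma>M (coord_field b z) \<xi>M) a q
             - second_ff B \<iota> \<Gamma> \<Gamma>M (?R (coord_field b z)) \<xi>M a q
             - second_ff B \<iota> \<Gamma> \<Gamma>M (coord_field b z) (?R \<xi>M) a q = 0"
      by (rule sp[unfolded semiparallel_def, rule_format, OF conjI[OF X conjI[OF xi conjI[OF X xi]]] b(2) a iq])
    moreover have "normal_curvature B \<iota> g \<Gamma> (coord_field b x) \<xi>M (second_ff B \<iota> \<Gamma> \<Gamma>M (coord_field b z) \<xi>M) a q = 0"
    proof (rule normal_curvature_0[OF sub.openin_chart[OF b(1)] b(2) a iq])
      fix p assume p: "p \<in> chart_dom b" "\<iota> p \<in> chart_dom a"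
      note pS = sub.in_topspace[OF b(1) p(1)]
      show "second_ff B \<iota> \<Gamma> \<Gamma>M (coord_field b z) \<xi>M a p = 0"
        unfolding second_ff_eq[OF X xi p(1) sub.chart_at[OF pS] a p(2)]
        by (rule H_xiM[OF refl pS a p(2)])
    qed
    ultimately have "?H ?K = 0"
      using second_ff_eq[OF sub.smooth_curvature[OF X xi X] xi b(2) b a iq]
        second_ff_eq[OF X sub.smooth_curvature[OF X xi xi] b(2) b a iq] H0
      by (simp add: sub.coord_field_self[OF b])
    moreover have "?K = \<alpha> *\<^sub>R y + ?f\<^sup>2 *\<^sub>R (x - \<eta> a (\<iota> q) (?J x) *\<^sub>R \<xi>M b q)"
    proof (rule injD[OF inj])
      show "?J ?K = ?J (\<alpha> *\<^sub>R y + ?f\<^sup>2 *\<^sub>R (x - \<eta> a (\<iota> q) (?J x) *\<^sub>R \<xi>M b q))"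
        using curvature_xiM[OF q a iq, of x, folded b_def, folded \<alpha>_def] y J_xiM[OF b(1) a b(2) iq]
        by (simp add: linear_add[OF lin] linear_diff[OF lin] linear_cmul[OF lin])
    qed
    ultimately show ?thesis
      by (simp add: linear_add[OF lH] linear_diff[OF lH] linear_cmul[OF lH] H0)
  qed
  obtain y where y: "?J y = ?\<phi> (?J x)" using invariantD(2)[OF b(1) a b(2) iq] by (metis imageE)
  \<comment> \<open>Represents \<phi> applied twice to X. Since \<open>?H\<close> kills \<xi>M, it
    contributes only \<open>- ?H x\<close>.\<close>
  let ?y' = "\<eta> a (\<iota> q) (?J x) *\<^sub>R \<xi>M b q - x"
  have "?J ?y' = ?\<phi> (?J y)"
    unfolding y acm_pointwise(1)[OF a iq]
    by (simp add: linear_diff[OF lin] linear_cmul[OF lin] J_xiM[OF b(1) a b(2) iq])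
  from key[OF this] have "?f\<^sup>2 *\<^sub>R ?H y = \<alpha> *\<^sub>R ?H x"
    by (simp add: linear_diff[OF lH] linear_cmul[OF lH] H0)
  \<comment> \<open>Multiplying by \<open>?f\<^sup>2\<close> makes \<open>?H y\<close> replaceable
    through the other relation, without division by \<alpha>, which may vanish.\<close>
  moreover have "?f\<^sup>2 *\<^sub>R (\<alpha> *\<^sub>R ?H y + ?f\<^sup>2 *\<^sub>R ?H x) = 0" using key[OF y] by simp
  ultimately have "\<alpha> *\<^sub>R (\<alpha> *\<^sub>R ?H x) + ?f\<^sup>2 *\<^sub>R (?f\<^sup>2 *\<^sub>R ?H x) = 0"
    by (metis scaleR_add_right scaleR_left_commute)
  then have "(\<alpha>\<^sup>2 + (?f\<^sup>2)\<^sup>2) *\<^sub>R ?H x = 0" by (simp add: power2_eq_square algebra_simps)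
  moreover have "?f \<noteq> 0" using f iota_in_topspace[OF b] by (simp add: f_def)
  then have "\<alpha>\<^sup>2 + (?f\<^sup>2)\<^sup>2 > 0" by (simp add: add_nonneg_pos)
  ultimately show ?thesis by (simp add: b_def)
qed

lemma semiparallel_imp_totally_geodesic:
  assumes "semiparallel S B A \<iota> g \<Gamma> \<Gamma>M" "\<forall>p\<in>topspace T. f1 p \<noteq> f3 p"
  shows "totally_geodesic S B A \<iota> \<Gamma> \<Gamma>M"
  unfolding totally_geodesic_def
proof (intro allI impI ballI)
  fix V X Y q a
  assume XY: "smooth_vector_field S B V X \<and> smooth_vector_field S B V Y" and q: "q \<in> V"
    and a: "a \<in> A" "\<iota> q \<in> chart_dom a"
  then have qS: "q \<in> topspace S" using sub.vector_field_openin openin_subset by blast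
  show "second_ff B \<iota> \<Gamma> \<Gamma>M X Y a q = 0"
    unfolding second_ff_eq[OF conjunct1[OF XY] conjunct2[OF XY] q sub.chart_at[OF qS] a]
    by (rule semiparallel_imp_H_eq_0[OF assms qS a])
qed

text \<open>Curvature fields are again smooth fields of \<open>M\<close>, so h vanishes on them too;
  the remaining term is the normal curvature of a field that vanishes on an open set.\<close>

lemma totally_geodesic_imp_semiparallel:
  assumes "totally_geodesic S B A \<iota> \<Gamma> \<Gamma>M"
  shows "semiparallel S B A \<iota> g \<Gamma> \<Gamma>M"
  unfolding semiparallel_def
proof (intro allI impI ballI, elim conjE)
  fix V X Y Z U q a
  assume q: "q \<in> V" and a: "a \<in> A" "\<iota> q \<in> chart_dom a"
    and X: "smooth_vector_field S B V X" and Y: "smooth_vector_field S B V Y"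
    and Z: "smooth_vector_field S B V Z" and U: "smooth_vector_field S B V U"
  have h: "second_ff B \<iota> \<Gamma> \<Gamma>M X Y a q = 0"
    if "smooth_vector_field S B V X" "smooth_vector_field S B V Y" "q \<in> V" "\<iota> q \<in> chart_dom a" for X Y q
    using assms that a(1) unfolding totally_geodesic_def by blast
  have normal: "normal_curvature B \<iota> g \<Gamma> X Y (second_ff B \<iota> \<Gamma> \<Gamma>M Z U) a q = 0"
    by (rule normal_curvature_0[OF sub.vector_field_openin[OF X] q a]) (rule h[OF Z U])
  show "normal_curvature B \<iota> g \<Gamma> X Y (second_ff B \<iota> \<Gamma> \<Gamma>M Z U) a q
      - second_ff B \<iota> \<Gamma> \<Gamma>M (curvature B \<Gamma>M X Y Z) U a q
      - second_ff B \<iota> \<Gamma> \<Gamma>M Z (curvature B \<Gamma>M X Y U) a q = 0"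
    using normal h[OF sub.smooth_curvature[OF X Y Z] U q a(2)] h[OF Z sub.smooth_curvature[OF X Y U] q a(2)] by simp
qed

end

theorem corollary3p3:
  fixes n :: nat
    and T :: "'a topology" and A :: "('a, 'e::euclidean_space) chart set"
    and \<phi> :: "('a, 'e) chart \<Rightarrow> 'a \<Rightarrow> 'e \<Rightarrow> 'e" and \<xi> :: "('a, 'e) field"
    and \<eta> :: "('a, 'e) chart \<Rightarrow> 'a \<Rightarrow> 'e \<Rightarrow> real"
    and g :: "('a, 'e) chart \<Rightarrow> 'a \<Rightarrow> 'e \<Rightarrow> 'e \<Rightarrow> real"
    and \<Gamma> :: "('a, 'e) christoffel"
    and f1 f2 f3 :: "'a \<Rightarrow> real"
    and S :: "'b topology" and B :: "('b, 'f::euclidean_space) chart set"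
    and \<iota> :: "'b \<Rightarrow> 'a"
    and gM :: "('b, 'f) chart \<Rightarrow> 'b \<Rightarrow> 'f \<Rightarrow> 'f \<Rightarrow> real"
    and \<Gamma>M :: "('b, 'f) christoffel"
  assumes "gen_sasakian_space_form n T A \<phi> \<xi> \<eta> g \<Gamma> f1 f2 f3"
    and "\<forall>p\<in>topspace T. f1 p \<noteq> f3 p"
    and "invariant_submanifold S B T A \<iota> \<phi> \<xi>"
    and "induced_metric B A \<iota> g gM"
    and "levi_civita S B gM \<Gamma>M"
  shows "totally_geodesic S B A \<iota> \<Gamma> \<Gamma>M \<longleftrightarrow> semiparallel S B A \<iota> g \<Gamma> \<Gamma>M"
proof -
  interpret invariant_gssf n T A \<phi> \<xi> \<eta> g \<Gamma> f1 f2 f3 S B \<iota> gM \<Gamma>M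
    using assms by unfold_locales
  show ?thesis
    using totally_geodesic_imp_semiparallel semiparallel_imp_totally_geodesic assms(2) by blast
qed

end
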